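(* Let $p\in\{0,1,2,\dots\}\cup\{\infty\}$ and let $\Omega$ be a Jordan domain bounded by an analytic Jordan curve $\gamma:\mathbb{R}\to\partial\Omega$. For every $f\in A(\Omega)$ the following equivalence holds: $f\in A^p(\Omega)$ if and only if $f\circ\gamma\in C^p(\mathbb{R})$. In this case, if $p\ge1$, then for all $t\in\mathbb{R}$ $$\frac{d(f\circ\gamma)}{dt}(t)=f'(\gamma(t))\cdot\gamma'(t),$$ where $f'(\gamma(t))$ denotes the value at $\gamma(t)$ of the continuous extension of $f'$ to $\overline{\Omega}$.
   Context: A Jordan domain is the bounded domain in $\mathbb{C}$ enclosed by a Jordan curve. That $\Omega$ is bounded by the analytic Jordan curve $\gamma:\mathbb{R}\to\partial\Omega$ means that $\gamma$ is a periodic parametrization of $\partial\Omega$ (onto $\partial\Omega$, and injective on each half-open interval of length one period) which is real-analytic with $\gamma'(t)\ne0$ for all $t\in\mathbb{R}$. $A(\Omega)$ is the set of functions $f:\overline{\Omega}\to\mathbb{C}$ that are continuous on $\overline{\Omega}$ and holomorphic in $\Omega$. $A^p(\Omega)$ is the set of holomorphic functions $f$ in $\Omega$ whose derivatives $f^{(l)}$, for all $l\in\{0,1,2,\dots\}$ with $l\le p$, extend continuously to $\overline{\Omega}$. *)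

theory Defs
  imports "HOL-Analysis.Analysis" "HOL-Library.Extended_Nat"
begin

definition Jordan_domain :: "complex set \<Rightarrow> bool" where
  "Jordan_domain \<Omega> \<longleftrightarrow>
     (\<exists>c. simple_path c \<and> pathfinish c = pathstart c \<and> \<Omega> = inside (path_image c))"

definition real_analytic :: "(real \<Rightarrow> complex) \<Rightarrow> bool" where
  "real_analytic \<gamma> \<longleftrightarrow>
     (\<forall>s. \<exists>r>0. \<exists>a :: nat \<Rightarrow> complex.
        \<forall>t. \<bar>t - s\<bar> < r \<longrightarrow> (\<lambda>n. (t - s) ^ n *\<^sub>R a n) sums \<gamma> t)"

definition bounded_by_analytic_Jordan_curve :: "complex set \<Rightarrow> (real \<Rightarrow> complex) \<Rightarrow> bool" where
  "bounded_by_analytic_Jordan_curve \<Omega> \<gamma> \<longleftrightarrow>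
     (\<exists>T>0. (\<forall>t. \<gamma> (t + T) = \<gamma> t) \<and> (\<forall>a. inj_on \<gamma> {a..<a + T})) \<and>
     range \<gamma> = frontier \<Omega> \<and>
     real_analytic \<gamma> \<and>
     (\<forall>t. vector_derivative \<gamma> (at t) \<noteq> 0)"

text \<open>Functions on \<open>closure \<Omega>\<close> or on \<open>\<Omega>\<close> are represented by total functions;
  only their values on the respective set matter below.\<close>

definition A_space :: "complex set \<Rightarrow> (complex \<Rightarrow> complex) set" where
  "A_space \<Omega> = {f. continuous_on (closure \<Omega>) f \<and> f holomorphic_on \<Omega>}"

definition continuous_extension ::
    "complex set \<Rightarrow> (complex \<Rightarrow> complex) \<Rightarrow> (complex \<Rightarrow> complex) \<Rightarrow> bool" where
  "continuous_extension \<Omega> h g \<longleftrightarrow> continuous_on (closure \<Omega>) g \<and> (\<forall>z\<in>\<Omega>. g z = h z)"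

text \<open>The order of differentiability \<open>p\<close> is an extended natural number; the strict
  inequality \<open>enat l < p\<close> in \<open>C_real\<close> says that the derivative of order \<open>l + 1 \<le> p\<close> exists.\<close>

definition Ap_space :: "enat \<Rightarrow> complex set \<Rightarrow> (complex \<Rightarrow> complex) set" where
  "Ap_space p \<Omega> = {f. f holomorphic_on \<Omega> \<and>
     (\<forall>l. enat l \<le> p \<longrightarrow> (\<exists>g. continuous_extension \<Omega> ((deriv ^^ l) f) g))}"

definition iterated_derivative :: "nat \<Rightarrow> (real \<Rightarrow> complex) \<Rightarrow> real \<Rightarrow> complex" where
  "iterated_derivative l = (\<lambda>h t. vector_derivative h (at t)) ^^ l"

definition C_real :: "enat \<Rightarrow> (real \<Rightarrow> complex) set" where
  "C_real p = {h.
     (\<forall>l. enat l < p \<longrightarrow> (\<forall>t. iterated_derivative l h differentiable (at t))) \<and>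
     (\<forall>l. enat l \<le> p \<longrightarrow> continuous_on UNIV (iterated_derivative l h))}"

end

theory Submission
  imports Defs "HOL-Complex_Analysis.Conformal_Mappings" "HOL-Library.Periodic_Fun"
begin

text \<open>Near a boundary point \<open>\<gamma>\<close> extends to an injective holomorphic map, by which \<open>f\<close> is pulled back to
  a function \<open>g\<close> that is holomorphic in the upper half of a disc and continuous up to the real axis,
  where it equals \<open>f \<circ> \<gamma>\<close>. If \<open>g'\<close> has a limit at a real point, the mean value inequality on the half disc
  shows that the limit is the derivative of \<open>g\<close> along the real axis. Conversely, if \<open>g\<close> is \<open>C\<^sup>1\<close> along
  the real axis, then after subtracting a linear function its derivative there is small near the
  given point, and a weighted maximum principle for difference quotients transports this smallness
  to \<open>g'\<close>. This settles \<open>p = 1\<close>; induction on \<open>p\<close>, with \<open>f'\<close> in place of \<open>f\<close>, does the rest, because \<open>\<gamma>'\<close>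
  and \<open>1 / \<gamma>'\<close> are smooth.\<close>

section \<open>Boundary derivatives in a half disc\<close>

lemma Im_ge_of_dist: "0 \<le> Im w" if "norm (\<xi> - w) \<le> Im \<xi>" for w \<xi> :: complex
  using abs_Im_le_cmod[of "\<xi> - w"] that by simp

lemma Im_gt_of_dist: "0 < Im w" if "norm (\<xi> - w) < Im \<xi>" for w \<xi> :: complex
  using abs_Im_le_cmod[of "\<xi> - w"] that by simp

lemma open_half_disc: "open {z. cmod z < r \<and> 0 < Im z}"
  unfolding Collect_conj_eq
  by (intro open_Int open_Collect_less continuous_intros)

lemma convex_half_disc: "convex {z. cmod z < r \<and> 0 < Im z}"
proof -
  have "{z. cmod z < r \<and> 0 < Im z} = ball 0 r \<inter> {z. 0 < Im z}" by auto
  then show ?thesis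
    by (simp only:) (intro convex_Int convex_ball convex_halfspace_Im_gt)
qed

lemma closed_half_disc: "closed {z. cmod z \<le> r \<and> 0 \<le> Im z}"
  unfolding Collect_conj_eq
  by (intro closed_Int closed_Collect_le continuous_intros)

lemma frontier_half_disc:
  assumes "z \<in> frontier {z. cmod z < r \<and> 0 < Im z}"
  shows "cmod z \<le> r" "0 \<le> Im z" "cmod z = r \<or> Im z = 0"
proof -
  have "closure {z. cmod z < r \<and> 0 < Im z} \<subseteq> {z. cmod z \<le> r \<and> 0 \<le> Im z}"
    by (rule closure_minimal) (auto intro: closed_half_disc)
  moreover have "z \<in> closure {z. cmod z < r \<and> 0 < Im z}" "z \<notin> {z. cmod z < r \<and> 0 < Im z}"
    using assms unfolding frontier_def interior_open[OF open_half_disc] by blast+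
  ultimately show "cmod z \<le> r" "0 \<le> Im z" "cmod z = r \<or> Im z = 0"
    by auto
qed

lemma mult_exp_minus_le_one: "x * exp (- x) \<le> (1::real)"
  using exp_ge_add_one_self[of x] by (simp add: exp_minus field_simps del: exp_ge_add_one_self)

text \<open>The weight \<open>(1 - (z / a)\<^sup>2)\<^sup>2\<close> has modulus \<open>4 (Im z)\<^sup>2 / a\<^sup>2\<close> on the circle of radius \<open>a\<close>. This
  compensates Cauchy's bound \<open>M / Im z\<close> for \<open>g'\<close> on the arc, including its two end points, and
  leaves a factor \<open>Im z\<close>, which \<open>exp (\<i> N z)\<close> turns into \<open>O(1 / N)\<close>. The maximum principle is applied
  to difference quotients of \<open>g\<close> in a real direction, because these extend continuously to the
  real axis.\<close>

lemma weighted_deriv_bound: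
  fixes g :: "complex \<Rightarrow> complex" and v :: "real \<Rightarrow> complex"
  assumes a: "0 < a" and N: "0 < N" "4 * M \<le> \<epsilon> * a\<^sup>2 * N"
    and contg: "continuous_on {z. cmod z \<le> 3 * a \<and> 0 \<le> Im z} g"
    and holg: "g holomorphic_on {z. cmod z < 3 * a \<and> 0 < Im z}"
    and M: "\<And>z. cmod z \<le> 3 * a \<Longrightarrow> 0 \<le> Im z \<Longrightarrow> cmod (g z) \<le> M"
    and dv: "\<And>t. \<bar>t\<bar> \<le> 2 * a \<Longrightarrow> ((\<lambda>t. g (of_real t)) has_vector_derivative v t) (at t)"
    and v: "\<And>t. \<bar>t\<bar> \<le> 2 * a \<Longrightarrow> cmod (v t) \<le> \<epsilon>"
    and z: "cmod z < a" "0 < Im z"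
  shows "cmod ((1 - (z / of_real a)\<^sup>2)\<^sup>2 * exp (\<i> * of_real N * z) * deriv g z) \<le> \<epsilon>"
proof -
  define W where "W = (\<lambda>z::complex. (1 - (z / of_real a)\<^sup>2)\<^sup>2 * exp (\<i> * of_real N * z))"
  define Q where "Q = (\<lambda>h z. (g (z + of_real h) - g z) / complex_of_real h)"
  define S where "S = {z. cmod z < a \<and> 0 < Im z}"
  have \<epsilon>: "0 \<le> \<epsilon>" using v[of 0] a by (smt (verit) norm_ge_zero)
  have M0: "0 \<le> M" using M[of 0] a by (smt (verit) norm_ge_zero norm_zero zero_complex.sel(2))
  have dg: "(g has_field_derivative deriv g w) (at w)" if "cmod w < 3 * a" "0 < Im w" for w
    using holomorphic_derivI[OF holg open_half_disc] that by simp
  \<comment> \<open>The disc of radius \<open>Im w\<close> about \<open>w\<close> touches the real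
    axis and reaches at most \<open>a\<close> beyond the radius \<open>2 * a\<close>. Hence
    \<open>g\<close> has to be given on the half disc of radius \<open>3 * a\<close>.\<close>
  have dgb: "cmod (deriv g w) \<le> M / Im w" if w: "cmod w \<le> 2 * a" "0 < Im w" "Im w \<le> a" for w
  proof -
    have sub: "cball w (Im w) \<subseteq> {z. cmod z \<le> 3 * a \<and> 0 \<le> Im z}"
    proof
      fix x assume "x \<in> cball w (Im w)"
      then have "cmod (w - x) \<le> Im w" by (simp add: dist_norm)
      then show "x \<in> {z. cmod z \<le> 3 * a \<and> 0 \<le> Im z}"
        using Im_ge_of_dist[of w x] norm_triangle_ineq4[of w "w - x"] w by simp
    qed
    have sub': "ball w (Im w) \<subseteq> {z. cmod z < 3 * a \<and> 0 < Im z}"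
    proof
      fix x assume "x \<in> ball w (Im w)"
      then have "cmod (w - x) < Im w" by (simp add: dist_norm)
      then show "x \<in> {z. cmod z < 3 * a \<and> 0 < Im z}"
        using Im_gt_of_dist[of w x] norm_triangle_ineq4[of w "w - x"] w by simp
    qed
    have "cmod ((deriv ^^ 1) g w) \<le> fact 1 * M / Im w ^ 1"
    proof (rule Cauchy_inequality)
      show "g holomorphic_on ball w (Im w)" using holg sub' holomorphic_on_subset by blast
      show "continuous_on (cball w (Im w)) g" using contg sub continuous_on_subset by blast
      show "cmod (g x) \<le> M" if "cmod (w - x) = Im w" for x
      proof -
        have "x \<in> cball w (Im w)" using that by (simp add: dist_norm)
        then show ?thesis using sub M by blast
      qed
    qed (use w in auto)
    then show ?thesis by simp
  qed
  \<comment> \<open>With \<open>h \<le> a\<close> the shifted points have modulus at most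
    \<open>2 * a\<close>, within reach of the hypotheses on \<open>v\<close> and of
    \<open>dgb\<close>.\<close>
  have key: "cmod (W z * Q h z) \<le> \<epsilon>" if h: "0 < h" "h \<le> a" for h
  proof (rule maximum_modulus_frontier[of "\<lambda>z. W z * Q h z" S])
    have shift: "cmod (w + of_real h) \<le> cmod w + h" for w
      using norm_triangle_ineq[of w "of_real h"] h by simp
    have int: "interior S = S" unfolding S_def by (rule interior_open[OF open_half_disc])
    have cl: "closure S \<subseteq> {z. cmod z \<le> a \<and> 0 \<le> Im z}"
      unfolding S_def by (rule closure_minimal) (auto intro: closed_half_disc)
    have holg1: "(\<lambda>z. g (z + of_real h)) holomorphic_on S"
    proof (rule holomorphic_on_compose_gen[of "\<lambda>z. z + of_real h" _ g, unfolded o_def])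
      show "(\<lambda>z. z + of_real h) ` S \<subseteq> {z. cmod z < 3 * a \<and> 0 < Im z}"
      proof clarify
        fix w assume "w \<in> S"
        then show "cmod (w + of_real h) < 3 * a \<and> 0 < Im (w + of_real h)"
          using shift[of w] h a by (simp add: S_def)
      qed
    qed (auto intro!: holomorphic_intros holg)
    have "g holomorphic_on S"
      using holg by (rule holomorphic_on_subset) (use a in \<open>auto simp: S_def\<close>)
    then show "(\<lambda>z. W z * Q h z) holomorphic_on interior S"
      unfolding int W_def Q_def using a h by (intro holomorphic_intros holg1) auto
    have contg1: "continuous_on (closure S) (\<lambda>z. g (z + of_real h))"
      using contg
    proof (rule continuous_on_compose2)
      show "(\<lambda>z. z + of_real h) ` closure S \<subseteq> {z. cmod z \<le> 3 * a \<and> 0 \<le> Im z}"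
      proof clarify
        fix w assume "w \<in> closure S"
        then have "w \<in> {z. cmod z \<le> a \<and> 0 \<le> Im z}" using cl by blast
        then show "cmod (w + of_real h) \<le> 3 * a \<and> 0 \<le> Im (w + of_real h)"
          using shift[of w] h a by simp
      qed
    qed (intro continuous_intros)
    have "continuous_on (closure S) g"
      using contg by (rule continuous_on_subset) (use a cl in auto)
    then show "continuous_on (closure S) (\<lambda>z. W z * Q h z)"
      unfolding W_def Q_def using a h by (intro continuous_intros contg1) auto
    show "bounded S"
      by (rule bounded_subset[of "ball 0 a"]) (auto simp: S_def)
    show "z \<in> S" using z by (simp add: S_def)
    show "cmod (W w * Q h w) \<le> \<epsilon>" if "w \<in> frontier S" for w
    proof -
      have w: "cmod w \<le> a" "0 \<le> Im w" "cmod w = a \<or> Im w = 0"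
        using frontier_half_disc that unfolding S_def by blast+
      have W: "cmod (W w) = (cmod (1 - (w / of_real a)\<^sup>2))\<^sup>2 * exp (- N * Im w)"
        by (simp add: W_def norm_mult norm_power)
      show ?thesis
      proof (cases "Im w = 0")
        case True
        then obtain x where x: "w = of_real x" by (metis complex_is_Real_iff Reals_cases)
        have xa: "\<bar>x\<bar> \<le> a" using w x by simp
        have "cmod (g (of_real (x + h)) - g (of_real x)) \<le> \<epsilon> * norm (x + h - x)"
        proof (rule differentiable_bound[where S = "{-2*a..2*a}" and f = "\<lambda>t. g (of_real t)"
                and f' = "\<lambda>t s. s *\<^sub>R v t"])
          fix t assume "t \<in> {-2*a..2*a}"
          then have t: "\<bar>t\<bar> \<le> 2 * a" by auto
          show "((\<lambda>t. g (of_real t)) has_derivative (\<lambda>s. s *\<^sub>R v t)) (at t within {-2*a..2*a})"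
            using dv[OF t] by (simp add: has_vector_derivative_def has_derivative_at_withinI)
          show "onorm (\<lambda>s. s *\<^sub>R v t) \<le> \<epsilon>"
          proof (rule onorm_le)
            fix s :: real
            have "\<bar>s\<bar> * cmod (v t) \<le> \<bar>s\<bar> * \<epsilon>" using v[OF t] by (intro mult_left_mono) auto
            then show "cmod (s *\<^sub>R v t) \<le> \<epsilon> * norm s" by (simp add: mult.commute)
          qed
        qed (use xa h in auto)
        then have "cmod (Q h w) \<le> \<epsilon>"
          using h by (simp add: Q_def x norm_divide field_simps)
        moreover have "cmod (W w) \<le> 1"
        proof -
          have "x\<^sup>2 \<le> a\<^sup>2" using xa a by (simp add: abs_le_square_iff[symmetric])
          then have "(x / a)\<^sup>2 \<le> 1" using a by (simp add: power_divide)
          moreover have "1 - (w / of_real a)\<^sup>2 = complex_of_real (1 - (x / a)\<^sup>2)"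
            by (simp add: x)
          ultimately have "cmod (1 - (w / of_real a)\<^sup>2) \<le> 1"
            by (simp only: norm_of_real) (smt (verit) zero_le_power2)
          then have "(cmod (1 - (w / of_real a)\<^sup>2))\<^sup>2 \<le> 1" by (simp add: power_le_one)
          then show ?thesis using W True by simp
        qed
        ultimately show ?thesis
          using mult_mono[of "cmod (W w)" 1 "cmod (Q h w)" \<epsilon>] by (simp add: norm_mult)
      next
        case False
        then have wa: "cmod w = a" "0 < Im w" using w by auto
        define y where "y = Im w"
        have y: "0 < y" "y \<le> a" using wa abs_Im_le_cmod[of w] by (auto simp: y_def)
        \<comment> \<open>The segment from \<open>w\<close> to \<open>w + of_real h\<close> is
          horizontal, so Cauchy's bound is the same \<open>M / y\<close> along all of it.\<close>
        have "cmod (g (w + of_real h) - g w) \<le> (M / y) * cmod (w + of_real h - w)"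
        proof (rule field_differentiable_bound[where S = "closed_segment w (w + of_real h)" and f' = "deriv g"])
          fix \<xi> assume "\<xi> \<in> closed_segment w (w + of_real h)"
          then obtain s where s: "0 \<le> s" "s \<le> 1" "\<xi> = w + of_real (s * h)"
            by (auto simp: in_segment algebra_simps scaleR_conv_of_real)
          have "cmod \<xi> \<le> cmod w + s * h" using norm_triangle_ineq[of w "of_real (s*h)"] s h by (simp add: norm_mult)
          also have "\<dots> \<le> a + 1 * a" unfolding wa using s h a by (intro add_left_mono mult_mono) auto
          finally have \<xi>: "cmod \<xi> \<le> 2 * a" "Im \<xi> = y" using s by (auto simp: y_def)
          show "(g has_field_derivative deriv g \<xi>) (at \<xi> within closed_segment w (w + of_real h))"
            using \<xi> y a by (intro has_field_derivative_at_within[OF dg]) auto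
          show "cmod (deriv g \<xi>) \<le> M / y" using dgb[of \<xi>] \<xi> y by simp
        qed auto
        then have Q: "cmod (Q h w) \<le> M / y"
          using h by (simp add: Q_def norm_divide field_simps)
        have "cmod (1 - (w / of_real a)\<^sup>2) = 2 * y / a"
        proof -
          \<comment> \<open>On the arc, replacing \<open>a\<^sup>2\<close> by
            \<open>w * cnj w\<close> brings out the factor \<open>cnj w - w\<close>, which measures
            the height \<open>y\<close>.\<close>
          have ww: "w * cnj w = (of_real a)\<^sup>2" using complex_norm_square[of w] wa by simp
          have "1 - (w / of_real a)\<^sup>2 = ((of_real a)\<^sup>2 - w\<^sup>2) / (of_real a)\<^sup>2"
            using a by (simp add: field_simps power_divide)
          also have "(of_real a)\<^sup>2 - w\<^sup>2 = w * (cnj w - w)"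
            unfolding ww[symmetric] by (simp add: algebra_simps power2_eq_square)
          also have "cnj w - w = - (2 * \<i> * of_real y)"
            by (simp add: y_def complex_eq_iff)
          finally show ?thesis
            using wa y by (simp add: norm_mult norm_divide norm_power power2_eq_square)
        qed
        then have "cmod (W w * Q h w) = (2 * y / a)\<^sup>2 * exp (- N * y) * cmod (Q h w)"
          by (simp add: norm_mult W y_def)
        also have "\<dots> \<le> (2 * y / a)\<^sup>2 * exp (- N * y) * (M / y)"
          using Q by (intro mult_left_mono) auto
        also have "\<dots> = (4 * M / (a\<^sup>2 * N)) * ((N * y) * exp (- (N * y)))"
          using y N a by (simp add: field_simps power2_eq_square)
        also have "\<dots> \<le> (4 * M / (a\<^sup>2 * N)) * 1"
          using M0 N by (intro mult_left_mono mult_exp_minus_le_one) auto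
        also have "\<dots> \<le> \<epsilon>" using N a by (simp add: field_simps)
        finally show ?thesis .
      qed
    qed
  qed
  \<comment> \<open>The bound \<open>\<epsilon>\<close> does not depend on \<open>h\<close>, so it
    survives the limit of the quotients as \<open>h\<close> decreases to 0.\<close>
  have "((\<lambda>h. (g (z + h) - g z) / h) \<longlongrightarrow> deriv g z) (at 0)"
    using dg[of z] z a by (simp add: DERIV_def)
  then have "((\<lambda>h. Q h z) \<longlongrightarrow> deriv g z) (at_right 0)"
    unfolding Q_def
    by (rule filterlim_compose[where g = "\<lambda>h. (g (z + h) - g z) / h"])
       (auto simp: filterlim_at eventually_at_filter intro!: tendsto_eq_intros)
  then have "((\<lambda>h. cmod (W z * Q h z)) \<longlongrightarrow> cmod (W z * deriv g z)) (at_right 0)"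
    by (intro tendsto_intros)
  moreover have "\<forall>\<^sub>F h in at_right 0. cmod (W z * Q h z) \<le> \<epsilon>"
    unfolding eventually_at_right_field using key a by (intro exI[of _ a]) auto
  ultimately show ?thesis
    unfolding W_def by (intro tendsto_upperbound) auto
qed

text \<open>The weighted bound is applied to \<open>g\<close> minus the linear function of slope
  \<open>v 0\<close>, whose boundary derivative \<open>v t - v 0\<close> is small near 0. The weight
  equals 1 at 0 and can be removed there at the cost of a constant factor.\<close>

lemma deriv_tendsto_boundary:
  fixes g :: "complex \<Rightarrow> complex" and v :: "real \<Rightarrow> complex"
  assumes r: "0 < r"
    and contg: "continuous_on {z. cmod z < r \<and> 0 \<le> Im z} g"
    and holg: "g holomorphic_on {z. cmod z < r \<and> 0 < Im z}"
    and dv: "\<And>t. \<bar>t\<bar> < r \<Longrightarrow> ((\<lambda>t. g (of_real t)) has_vector_derivative v t) (at t)"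
    and v: "isCont v 0"
  shows "(deriv g \<longlongrightarrow> v 0) (at 0 within {z. 0 < Im z})"
proof (rule tendstoI)
  fix e :: real assume e: "0 < e"
  \<comment> \<open>One third of \<open>e\<close>: dividing by a weight above \<open>1/2\<close>
    costs a factor 2, and the final inequality is strict.\<close>
  define \<epsilon> where "\<epsilon> = e / 3"
  have \<epsilon>: "0 < \<epsilon>" using e by (simp add: \<epsilon>_def)
  define G where "G = (\<lambda>z. g z - v 0 * z)"
  obtain d where d: "0 < d" "\<And>t. \<bar>t\<bar> < d \<Longrightarrow> cmod (v t - v 0) < \<epsilon>"
    using v \<epsilon> unfolding continuous_at_eps_delta by (metis dist_norm diff_zero real_norm_def)
  \<comment> \<open>\<open>3 * a < r\<close> leaves a compact half disc on which \<open>G\<close> is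
    bounded; \<open>2 * a < d\<close> keeps the boundary derivative of \<open>G\<close> below
    \<open>\<epsilon>\<close>.\<close>
  define a where "a = min r d / 4"
  have a: "0 < a" "3 * a < r" "2 * a < d" using r d by (auto simp: a_def)
  have contG: "continuous_on {z. cmod z \<le> 3 * a \<and> 0 \<le> Im z} G"
    unfolding G_def using a
    by (intro continuous_intros continuous_on_subset[OF contg]) auto
  have holG: "G holomorphic_on {z. cmod z < 3 * a \<and> 0 < Im z}"
    unfolding G_def using a
    by (intro holomorphic_intros holomorphic_on_subset[OF holg]) auto
  have "bounded {z. cmod z \<le> 3 * a \<and> 0 \<le> Im z}"
    by (rule bounded_subset[of "cball 0 (3 * a)"]) auto
  then have "compact {z. cmod z \<le> 3 * a \<and> 0 \<le> Im z}"
    using closed_half_disc by (simp add: compact_eq_bounded_closed)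
  then have "bounded (G ` {z. cmod z \<le> 3 * a \<and> 0 \<le> Im z})"
    using contG compact_continuous_image compact_imp_bounded by blast
  then obtain M where M: "\<And>z. cmod z \<le> 3 * a \<Longrightarrow> 0 \<le> Im z \<Longrightarrow> cmod (G z) \<le> M"
    by (auto simp: bounded_iff)
  \<comment> \<open>\<open>N\<close> is chosen after \<open>M\<close>, which depends on
    \<open>a\<close>. A large \<open>N\<close> only shrinks the neighbourhood of 0 on which
    \<open>W\<close> stays close to 1.\<close>
  define N where "N = max 1 (4 * M / (\<epsilon> * a\<^sup>2))"
  have N: "0 < N" "4 * M \<le> \<epsilon> * a\<^sup>2 * N"
  proof -
    have "4 * M / (\<epsilon> * a\<^sup>2) \<le> N" by (simp add: N_def)
    then show "4 * M \<le> \<epsilon> * a\<^sup>2 * N" using \<epsilon> a by (simp add: field_simps)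
  qed (simp add: N_def)
  define W where "W = (\<lambda>z::complex. (1 - (z / of_real a)\<^sup>2)\<^sup>2 * exp (\<i> * of_real N * z))"
  have WG: "cmod (W z * deriv G z) \<le> \<epsilon>" if "cmod z < a" "0 < Im z" for z
    unfolding W_def
  proof (rule weighted_deriv_bound[OF a(1) N contG holG M _ _ that])
    fix t :: real assume t: "\<bar>t\<bar> \<le> 2 * a"
    show "((\<lambda>t. G (of_real t)) has_vector_derivative v t - v 0) (at t)"
      unfolding G_def
      by (rule has_vector_derivative_diff[OF dv])
         (use t a in \<open>auto intro!: has_vector_derivative_real_field derivative_eq_intros\<close>)
    show "cmod (v t - v 0) \<le> \<epsilon>" using d(2)[of t] t a by simp
  qed
  have "W \<midarrow>0\<rightarrow> W 0"
    unfolding W_def using a by (intro isContD continuous_intros) auto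
  then have "((\<lambda>z. cmod (W z)) \<longlongrightarrow> 1) (at 0 within {z. 0 < Im z})"
    using tendsto_norm[of W "W 0"] by (auto simp: W_def intro: tendsto_within_subset)
  then have ev: "\<forall>\<^sub>F z in at 0 within {z. 0 < Im z}. 1/2 < cmod (W z)"
    by (rule order_tendstoD) simp
  have ev2: "\<forall>\<^sub>F z in at 0 within {z. 0 < Im z}. cmod z < a \<and> 0 < Im z"
    unfolding eventually_at using a(1) by (intro exI[of _ a]) auto
  show "\<forall>\<^sub>F z in at 0 within {z. 0 < Im z}. dist (deriv g z) (v 0) < e"
    using ev ev2
  proof eventually_elim
    case (elim z)
    have "(g has_field_derivative deriv g z) (at z)"
      using elim a by (intro holomorphic_derivI[OF holg open_half_disc]) auto
    then have "(G has_field_derivative deriv g z - v 0) (at z)"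
      unfolding G_def by (auto intro!: derivative_eq_intros)
    then have "deriv G z = deriv g z - v 0" by (rule DERIV_imp_deriv)
    then have *: "cmod (W z) * cmod (deriv g z - v 0) \<le> \<epsilon>"
      using WG[of z] elim by (simp add: norm_mult)
    have "1/2 * cmod (deriv g z - v 0) \<le> cmod (W z) * cmod (deriv g z - v 0)"
      using elim by (intro mult_right_mono) auto
    then show ?case using * e by (simp add: dist_norm \<epsilon>_def)
  qed
qed

text \<open>After subtracting \<open>L * z\<close> the derivative has modulus at most
  \<open>e\<close> in a small half disc. By convexity the difference is \<open>e\<close>-Lipschitz
  there, by continuity also on the diameter, and this is the estimate that defines the derivative at
  0.\<close>

lemma has_vector_derivative_boundary:
  fixes g :: "complex \<Rightarrow> complex"
  assumes r: "0 < r"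
    and contg: "continuous_on {z. cmod z < r \<and> 0 \<le> Im z} g"
    and holg: "g holomorphic_on {z. cmod z < r \<and> 0 < Im z}"
    and lim: "(deriv g \<longlongrightarrow> L) (at 0 within {z. 0 < Im z})"
  shows "((\<lambda>t. g (of_real t)) has_vector_derivative L) (at 0)"
  unfolding has_vector_derivative_def has_derivative_at_alt
proof (intro conjI allI impI)
  fix e :: real assume e: "0 < e"
  obtain d0 where d0: "0 < d0" "\<And>z. 0 < Im z \<Longrightarrow> cmod z < d0 \<Longrightarrow> cmod (deriv g z - L) < e"
  proof -
    obtain d0 where "0 < d0"
        and d0: "\<forall>z\<in>{z. 0 < Im z}. z \<noteq> 0 \<and> dist z 0 < d0 \<longrightarrow> dist (deriv g z) L < e"
      using tendstoD[OF lim e] unfolding eventually_at by blast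
    have "cmod (deriv g z - L) < e" if "0 < Im z" "cmod z < d0" for z
    proof -
      have "z \<noteq> 0" using that by auto
      then show ?thesis using d0[rule_format, of z] that by (simp add: dist_norm)
    qed
    with \<open>0 < d0\<close> show ?thesis using that by blast
  qed
  define d where "d = min r d0"
  have d: "0 < d" "d \<le> r" "d \<le> d0" using d0 r by (auto simp: d_def)
  define G where "G = (\<lambda>z. g z - L * z)"
  define S where "S = {z. cmod z < d \<and> 0 < Im z}"
  have lip: "cmod (G z - G w) \<le> e * cmod (z - w)" if "z \<in> S" "w \<in> S" for z w
  proof (rule field_differentiable_bound[where S = S and f' = "\<lambda>z. deriv g z - L"])
    show "convex S" unfolding S_def by (rule convex_half_disc)
    fix x assume x: "x \<in> S"
    have "(g has_field_derivative deriv g x) (at x)"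
      using x d by (intro holomorphic_derivI[OF holg open_half_disc]) (auto simp: S_def)
    then have "(G has_field_derivative deriv g x - L) (at x)"
      unfolding G_def by (auto intro!: derivative_eq_intros)
    then show "(G has_field_derivative deriv g x - L) (at x within S)"
      by (rule has_field_derivative_at_within)
    show "cmod (deriv g x - L) \<le> e" using d0(2)[of x] x d by (auto simp: S_def)
  qed (use that in auto)
  have lim0: "((\<lambda>\<eta>. G (of_real t + \<i> * of_real \<eta>)) \<longlongrightarrow> G (of_real t)) (at_right 0)"
    if "\<bar>t\<bar> < d" for t
  proof -
    have cG: "continuous_on {z. cmod z < r \<and> 0 \<le> Im z} G"
      unfolding G_def by (intro continuous_intros contg)
    have ev: "\<forall>\<^sub>F \<eta> in at_right 0. of_real t + \<i> * of_real \<eta> \<in> {z. cmod z < r \<and> 0 \<le> Im z}"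
      unfolding eventually_at_right_field
    proof (intro exI[of _ "d - \<bar>t\<bar>"] conjI allI impI)
      fix \<eta> :: real assume "0 < \<eta>" "\<eta> < d - \<bar>t\<bar>"
      then show "of_real t + \<i> * of_real \<eta> \<in> {z. cmod z < r \<and> 0 \<le> Im z}"
        using norm_triangle_ineq[of "of_real t" "\<i> * of_real \<eta>"] d by (simp add: norm_mult)
    qed (use that in simp)
    show ?thesis
      by (rule continuous_on_tendsto_compose[OF cG _ _ ev]) (use that d in \<open>auto intro!: tendsto_eq_intros\<close>)
  qed
  show "\<exists>d>0. \<forall>y. norm (y - 0) < d \<longrightarrow>
    norm (g (of_real y) - g (of_real 0) - (y - 0) *\<^sub>R L) \<le> e * norm (y - 0)"
  proof (intro exI[of _ d] conjI allI impI)
    fix t :: real assume "norm (t - 0) < d"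
    then have t: "\<bar>t\<bar> < d" by simp
    \<comment> \<open>Raising both points by the same \<open>\<eta>\<close> keeps their distance
      \<open>\<bar>t\<bar>\<close>, so the Lipschitz bound passes to the limit
      \<open>\<eta> \<longlongrightarrow> 0\<close>.\<close>
    have "((\<lambda>\<eta>. cmod (G (of_real t + \<i> * of_real \<eta>) - G (of_real 0 + \<i> * of_real \<eta>)))
            \<longlongrightarrow> cmod (G (of_real t) - G (of_real 0))) (at_right 0)"
      using t d by (intro tendsto_intros lim0) auto
    moreover have "\<forall>\<^sub>F \<eta> in at_right 0.
        cmod (G (of_real t + \<i> * of_real \<eta>) - G (of_real 0 + \<i> * of_real \<eta>)) \<le> e * \<bar>t\<bar>"
      unfolding eventually_at_right_field
    proof (intro exI[of _ "d - \<bar>t\<bar>"] conjI allI impI)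
      fix \<eta> :: real assume \<eta>: "0 < \<eta>" "\<eta> < d - \<bar>t\<bar>"
      then have "of_real t + \<i> * of_real \<eta> \<in> S" "of_real 0 + \<i> * of_real \<eta> \<in> S"
        using norm_triangle_ineq[of "of_real t" "\<i> * of_real \<eta>"] by (auto simp: norm_mult S_def)
      from lip[OF this]
      show "cmod (G (of_real t + \<i> * of_real \<eta>) - G (of_real 0 + \<i> * of_real \<eta>)) \<le> e * \<bar>t\<bar>"
        by simp
    qed (use t in simp)
    ultimately have "cmod (G (of_real t) - G (of_real 0)) \<le> e * \<bar>t\<bar>"
      by (intro tendsto_upperbound) auto
    then show "norm (g (of_real t) - g (of_real 0) - (t - 0) *\<^sub>R L) \<le> e * norm (t - 0)"
      by (simp add: G_def algebra_simps scaleR_conv_of_real)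
  qed (use d in simp)
qed (simp add: bounded_linear_scaleR_left)

section \<open>Smooth functions on the real line\<close>

lemma C_real_mono: "h \<in> C_real p \<Longrightarrow> q \<le> p \<Longrightarrow> h \<in> C_real q"
  unfolding C_real_def by (auto intro: less_le_trans order_trans)

text \<open>Reduces \<open>p = \<infinity>\<close> to finite orders. Since \<open>enat l < p\<close>
  means \<open>enat (Suc l) \<le> p\<close>, each condition in \<open>C_real p\<close> already
  occurs at a finite order.\<close>

lemma C_real_iff_enat: "h \<in> C_real p \<longleftrightarrow> (\<forall>n. enat n \<le> p \<longrightarrow> h \<in> C_real (enat n))"
proof
  assume *: "\<forall>n. enat n \<le> p \<longrightarrow> h \<in> C_real (enat n)"
  have "\<forall>t. iterated_derivative l h differentiable at t" if "enat l < p" for l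
  proof -
    have "enat (Suc l) \<le> p" using that by (simp add: Suc_ile_eq)
    then show ?thesis using * by (auto simp: C_real_def)
  qed
  moreover have "continuous_on UNIV (iterated_derivative l h)" if "enat l \<le> p" for l
    using * that by (auto simp: C_real_def)
  ultimately show "h \<in> C_real p" by (auto simp: C_real_def)
qed (blast intro: C_real_mono)

lemma C_real_0_iff: "h \<in> C_real (enat 0) \<longleftrightarrow> continuous_on UNIV h"
  by (auto simp: C_real_def iterated_derivative_def)

lemma iterated_derivative_Suc:
  "iterated_derivative (Suc l) h = iterated_derivative l (\<lambda>t. vector_derivative h (at t))"
  unfolding iterated_derivative_def by (simp add: funpow_Suc_right del: funpow.simps)

text \<open>With its companion \<open>C_real_SucE\<close> this turns statements on
  \<open>C_real\<close> into inductions on the order with an explicit derivative.\<close>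

lemma C_real_Suc_iff:
  assumes h: "\<And>t. (h has_vector_derivative h' t) (at t)"
  shows "h \<in> C_real (enat (Suc n)) \<longleftrightarrow> h' \<in> C_real (enat n)"
proof -
  have h': "(\<lambda>t. vector_derivative h (at t)) = h'"
    using h by (auto intro: vector_derivative_at)
  have it: "iterated_derivative (Suc l) h = iterated_derivative l h'" for l
    by (simp add: iterated_derivative_Suc h')
  have 0: "iterated_derivative 0 h = h" by (simp add: iterated_derivative_def)
  have d: "h differentiable at t" for t
    using h by (rule differentiableI_vector)
  then have "continuous_on UNIV h"
    by (meson continuous_at_imp_continuous_on differentiable_imp_continuous_within)
  have split: "(\<forall>l. P l) \<longleftrightarrow> P 0 \<and> (\<forall>l. P (Suc l))" for P :: "nat \<Rightarrow> bool"
    by (metis not0_implies_Suc)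
  show ?thesis
    unfolding C_real_def mem_Collect_eq
    by (subst (1 2) split) (simp add: it 0 d \<open>continuous_on UNIV h\<close>)
qed

lemma C_real_SucE:
  assumes "h \<in> C_real (enat (Suc n))"
  obtains h' where "\<And>t. (h has_vector_derivative h' t) (at t)" "h' \<in> C_real (enat n)"
proof
  have "\<forall>t. iterated_derivative 0 h differentiable at t"
    using assms unfolding C_real_def zero_enat_def by (auto simp: Suc_ile_eq)
  then show *: "(h has_vector_derivative vector_derivative h (at t)) (at t)" for t
    by (simp add: iterated_derivative_def vector_derivative_works)
  show "(\<lambda>t. vector_derivative h (at t)) \<in> C_real (enat n)"
    using assms C_real_Suc_iff[OF *] by blast
qed

lemma C_real_add:
  "u \<in> C_real (enat n) \<Longrightarrow> v \<in> C_real (enat n) \<Longrightarrow> (\<lambda>t. u t + v t) \<in> C_real (enat n)"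
proof (induction n arbitrary: u v)
  case 0
  then show ?case unfolding C_real_0_iff by (intro continuous_intros)
next
  case (Suc n)
  obtain u' where u: "\<And>t. (u has_vector_derivative u' t) (at t)" "u' \<in> C_real (enat n)"
    using C_real_SucE Suc.prems(1) by blast
  obtain v' where v: "\<And>t. (v has_vector_derivative v' t) (at t)" "v' \<in> C_real (enat n)"
    using C_real_SucE Suc.prems(2) by blast
  show ?case
    using C_real_Suc_iff[OF has_vector_derivative_add[OF u(1) v(1)]] Suc.IH[OF u(2) v(2)] by blast
qed

lemma C_real_mult:
  "u \<in> C_real (enat n) \<Longrightarrow> v \<in> C_real (enat n) \<Longrightarrow> (\<lambda>t. u t * v t) \<in> C_real (enat n)"
proof (induction n arbitrary: u v)
  case 0
  then show ?case unfolding C_real_0_iff by (intro continuous_intros)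
next
  case (Suc n)
  obtain u' where u: "\<And>t. (u has_vector_derivative u' t) (at t)" "u' \<in> C_real (enat n)"
    using C_real_SucE Suc.prems(1) by blast
  obtain v' where v: "\<And>t. (v has_vector_derivative v' t) (at t)" "v' \<in> C_real (enat n)"
    using C_real_SucE Suc.prems(2) by blast
  \<comment> \<open>The product rule also contains \<open>u\<close> and \<open>v\<close>
    undifferentiated; they are lowered to order \<open>n\<close> to fit the induction
    hypothesis.\<close>
  have "u \<in> C_real (enat n)" "v \<in> C_real (enat n)"
    using Suc.prems C_real_mono[of _ "enat (Suc n)" "enat n"] by auto
  then have "(\<lambda>t. u t * v' t + u' t * v t) \<in> C_real (enat n)"
    using u(2) v(2) by (intro C_real_add Suc.IH)
  then show ?case
    using C_real_Suc_iff[OF has_vector_derivative_mult[OF u(1) v(1)]] by blast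
qed

text \<open>Real analyticity in the form used below. With local complex extensions in place of power
  series, derivatives and reciprocals are handled by facts on holomorphic functions.\<close>

definition holomorphically_extendable :: "(real \<Rightarrow> complex) \<Rightarrow> bool" where
  "holomorphically_extendable h \<longleftrightarrow>
     (\<forall>s. \<exists>\<delta>>0. \<exists>H. H holomorphic_on ball (complex_of_real s) \<delta> \<and>
        (\<forall>t. \<bar>t - s\<bar> < \<delta> \<longrightarrow> h t = H (of_real t)))"

lemma holomorphically_extendableE:
  assumes "holomorphically_extendable h"
  obtains \<delta> H where "0 < \<delta>" "H holomorphic_on ball (complex_of_real s) \<delta>"
    "\<And>t. \<bar>t - s\<bar> < \<delta> \<Longrightarrow> h t = H (of_real t)"
  using assms unfolding holomorphically_extendable_def by blast

lemma has_vector_derivative_extension: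
  assumes H: "H holomorphic_on ball (complex_of_real s) \<delta>"
    and h: "\<And>t. \<bar>t - s\<bar> < \<delta> \<Longrightarrow> h t = H (of_real t)" and t: "\<bar>t - s\<bar> < \<delta>"
  shows "(h has_vector_derivative deriv H (of_real t)) (at t)"
proof -
  have "(H has_field_derivative deriv H (of_real t)) (at (of_real t))"
    by (rule holomorphic_derivI[OF H open_ball]) (use t in \<open>simp add: dist_real_def abs_minus_commute\<close>)
  then have "((\<lambda>t. H (of_real t)) has_vector_derivative deriv H (of_real t)) (at t)"
    by (rule has_vector_derivative_real_field)
  then show ?thesis
    by (rule has_vector_derivative_transform_within_open[where S = "ball s \<delta>"])
       (use h t in \<open>auto simp: dist_real_def abs_minus_commute\<close>)
qed

text \<open>A power series that converges on a real interval converges in the complex disc with that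
  diameter: each point of the disc is compared with a real point \<open>s + x\<close> farther from
  the centre.\<close>

lemma real_analytic_imp_holomorphically_extendable:
  assumes "real_analytic \<gamma>"
  shows "holomorphically_extendable \<gamma>"
  unfolding holomorphically_extendable_def
proof
  fix s
  obtain r a where r: "0 < r"
    and a: "\<And>t. \<bar>t - s\<bar> < r \<Longrightarrow> (\<lambda>n. (t - s) ^ n *\<^sub>R a n) sums \<gamma> t"
    using assms unfolding real_analytic_def by blast
  define G where "G = (\<lambda>z. \<Sum>n. a n * (z - complex_of_real s) ^ n)"
  have G: "(\<lambda>n. a n * (z - of_real s) ^ n) sums G z" if "z \<in> ball (of_real s) r" for z
  proof -
    have "dist (of_real s) z < r" using that by simp
    then obtain x where x: "dist (of_real s) z < x" "x < r" using dense by blast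
    then have x0: "0 < x" using zero_le_dist[of "complex_of_real s" z] by linarith
    have "(\<lambda>n. x ^ n *\<^sub>R a n) sums \<gamma> (s + x)" using a[of "s + x"] x x0 by simp
    then have "summable (\<lambda>n. a n * of_real x ^ n)"
      by (simp add: sums_iff scaleR_conv_of_real mult.commute)
    then have "summable (\<lambda>n. a n * (z - of_real s) ^ n)"
      by (rule powser_inside) (use x x0 in \<open>simp add: dist_norm norm_minus_commute\<close>)
    then show ?thesis unfolding G_def by (rule summable_sums)
  qed
  have "G holomorphic_on ball (of_real s) r"
    by (rule power_series_holomorphic) (rule G)
  moreover have "\<gamma> t = G (of_real t)" if "\<bar>t - s\<bar> < r" for t
  proof (rule sums_unique2)
    show "(\<lambda>n. a n * (of_real t - of_real s) ^ n) sums \<gamma> t"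
      using a[OF that] by (simp add: scaleR_conv_of_real mult.commute)
    show "(\<lambda>n. a n * (of_real t - of_real s) ^ n) sums G (of_real t)"
      by (rule G) (use that in \<open>simp add: dist_real_def abs_minus_commute\<close>)
  qed
  ultimately show "\<exists>\<delta>>0. \<exists>H. H holomorphic_on ball (complex_of_real s) \<delta> \<and>
      (\<forall>t. \<bar>t - s\<bar> < \<delta> \<longrightarrow> \<gamma> t = H (of_real t))"
    using r by blast
qed

lemma holomorphically_extendable_has_vector_derivative:
  assumes "holomorphically_extendable h"
  shows "(h has_vector_derivative vector_derivative h (at t)) (at t)"
proof -
  obtain \<delta> H where "0 < \<delta>" "H holomorphic_on ball (complex_of_real t) \<delta>"
    "\<And>x. \<bar>x - t\<bar> < \<delta> \<Longrightarrow> h x = H (of_real x)"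
    using holomorphically_extendableE[OF assms, of t] by blast
  then have "(h has_vector_derivative deriv H (of_real t)) (at t)"
    by (intro has_vector_derivative_extension) auto
  then show ?thesis by (simp add: vector_derivative_at)
qed

lemma holomorphically_extendable_deriv:
  assumes "holomorphically_extendable h"
  shows "holomorphically_extendable (\<lambda>t. vector_derivative h (at t))"
  unfolding holomorphically_extendable_def
proof
  fix s
  obtain \<delta> H where *: "0 < \<delta>" "H holomorphic_on ball (complex_of_real s) \<delta>"
    "\<And>x. \<bar>x - s\<bar> < \<delta> \<Longrightarrow> h x = H (of_real x)"
    using holomorphically_extendableE[OF assms, of s] by blast
  then have "deriv H holomorphic_on ball (of_real s) \<delta>"
    by (intro holomorphic_deriv) auto
  moreover have "vector_derivative h (at t) = deriv H (of_real t)" if "\<bar>t - s\<bar> < \<delta>" for t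
    using * that by (intro vector_derivative_at has_vector_derivative_extension)
  ultimately show "\<exists>\<delta>>0. \<exists>H. H holomorphic_on ball (complex_of_real s) \<delta> \<and>
      (\<forall>t. \<bar>t - s\<bar> < \<delta> \<longrightarrow> vector_derivative h (at t) = H (of_real t))"
    using * by blast
qed

text \<open>The hypothesis excludes real zeros only; by continuity the disc can be shrunk until
  \<open>H\<close> has no complex zero either.\<close>

lemma holomorphically_extendable_inverse:
  assumes "holomorphically_extendable h" and "\<And>t. h t \<noteq> 0"
  shows "holomorphically_extendable (\<lambda>t. inverse (h t))"
  unfolding holomorphically_extendable_def
proof
  fix s
  obtain \<delta> H where *: "0 < \<delta>" "H holomorphic_on ball (complex_of_real s) \<delta>"
    "\<And>x. \<bar>x - s\<bar> < \<delta> \<Longrightarrow> h x = H (of_real x)"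
    using holomorphically_extendableE[OF assms(1), of s] by blast
  have "continuous_on (ball (of_real s) \<delta>) H" using * holomorphic_on_imp_continuous_on by blast
  moreover have "H (of_real s) \<noteq> 0" using * assms(2)[of s] by auto
  ultimately obtain e where e: "0 < e" "\<forall>z \<in> ball (of_real s) \<delta>. dist (of_real s) z < e \<longrightarrow> H z \<noteq> 0"
    using continuous_on_avoid[of "ball (of_real s) \<delta>" H "of_real s" 0] * by auto
  define d where "d = min \<delta> e"
  have d: "0 < d" "d \<le> \<delta>" "d \<le> e" using * e by (auto simp: d_def)
  have "(\<lambda>z. inverse (H z)) holomorphic_on ball (of_real s) d"
    using d e by (intro holomorphic_intros holomorphic_on_subset[OF *(2)]) auto
  then show "\<exists>\<delta>>0. \<exists>H. H holomorphic_on ball (complex_of_real s) \<delta> \<and>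
      (\<forall>t. \<bar>t - s\<bar> < \<delta> \<longrightarrow> inverse (h t) = H (of_real t))"
    using d * by (intro exI[of _ d] conjI exI[of _ "\<lambda>z. inverse (H z)"]) auto
qed

text \<open>Extendability passes to the derivative, so the order can be raised indefinitely. This
  makes \<open>\<gamma>'\<close> and its reciprocal smooth factors in the main induction.\<close>

lemma holomorphically_extendable_imp_C_real:
  "holomorphically_extendable h \<Longrightarrow> h \<in> C_real (enat n)"
proof (induction n arbitrary: h)
  case 0
  then show ?case
    unfolding C_real_0_iff
    by (meson continuous_at_imp_continuous_on has_vector_derivative_continuous
        holomorphically_extendable_has_vector_derivative)
next
  case (Suc n)
  then show ?case
    using C_real_Suc_iff[OF holomorphically_extendable_has_vector_derivative]
      holomorphically_extendable_deriv by blast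
qed

section \<open>The spaces of holomorphic functions\<close>

lemma Ap_space_iff_enat:
  assumes "f holomorphic_on \<Omega>"
  shows "f \<in> Ap_space p \<Omega> \<longleftrightarrow> (\<forall>n. enat n \<le> p \<longrightarrow> f \<in> Ap_space (enat n) \<Omega>)"
proof
  assume "f \<in> Ap_space p \<Omega>"
  then show "\<forall>n. enat n \<le> p \<longrightarrow> f \<in> Ap_space (enat n) \<Omega>"
    unfolding Ap_space_def by (blast intro: order_trans)
next
  assume "\<forall>n. enat n \<le> p \<longrightarrow> f \<in> Ap_space (enat n) \<Omega>"
  then show "f \<in> Ap_space p \<Omega>"
    using assms unfolding Ap_space_def by blast
qed

lemma Ap_space_0: "f \<in> A_space \<Omega> \<Longrightarrow> f \<in> Ap_space (enat 0) \<Omega>"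
  by (auto simp: A_space_def Ap_space_def continuous_extension_def)

text \<open>Allows the induction on the order to pass from \<open>f\<close> to the extension of its
  derivative.\<close>

lemma continuous_extension_deriv_in_A_space:
  assumes "open \<Omega>" "f holomorphic_on \<Omega>" "continuous_extension \<Omega> (deriv f) f'"
  shows "f' \<in> A_space \<Omega>"
proof -
  have "deriv f holomorphic_on \<Omega>" using assms by (intro holomorphic_deriv)
  then have "f' holomorphic_on \<Omega>"
    by (rule holomorphic_transform) (use assms in \<open>auto simp: continuous_extension_def\<close>)
  then show ?thesis using assms by (simp add: A_space_def continuous_extension_def)
qed

lemma all_le_Suc_iff: "(\<forall>l\<le>Suc n. P l) \<longleftrightarrow> P 0 \<and> (\<forall>l\<le>n. P (Suc l))"
  by (metis Suc_le_mono not0_implies_Suc zero_le)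

text \<open>The extension \<open>f'\<close> agrees with \<open>deriv f\<close> on the open set
  \<open>\<Omega>\<close>, hence so do all higher derivatives, and the orders shift by one. Order 0
  is covered by \<open>f\<close>, which is its own extension.\<close>

lemma Ap_space_Suc_iff:
  assumes "open \<Omega>" "f \<in> A_space \<Omega>"
  shows "f \<in> Ap_space (enat (Suc n)) \<Omega> \<longleftrightarrow>
    (\<exists>f'. continuous_extension \<Omega> (deriv f) f' \<and> f' \<in> Ap_space (enat n) \<Omega>)"
proof -
  have holf: "f holomorphic_on \<Omega>" using assms by (simp add: A_space_def)
  have *: "f' \<in> Ap_space (enat n) \<Omega> \<longleftrightarrow>
      (\<forall>l\<le>n. \<exists>g. continuous_extension \<Omega> ((deriv ^^ Suc l) f) g)"
    if "continuous_extension \<Omega> (deriv f) f'" for f'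
  proof -
    have holf': "f' holomorphic_on \<Omega>"
      using continuous_extension_deriv_in_A_space[OF assms(1) holf that] by (simp add: A_space_def)
    have "(deriv ^^ l) f' z = (deriv ^^ Suc l) f z" if "z \<in> \<Omega>" for z l
    proof -
      have "(deriv ^^ l) f' z = (deriv ^^ l) (deriv f) z"
        using \<open>continuous_extension \<Omega> (deriv f) f'\<close> holf holf' assms(1) that
        by (intro higher_deriv_transform_within_open[where S = \<Omega>] holomorphic_deriv)
           (auto simp: continuous_extension_def)
      then show ?thesis by (simp add: funpow_swap1)
    qed
    then have "continuous_extension \<Omega> ((deriv ^^ l) f') g \<longleftrightarrow>
        continuous_extension \<Omega> ((deriv ^^ Suc l) f) g" for l g
      unfolding continuous_extension_def by simp
    then show ?thesis using holf' unfolding Ap_space_def by simp blast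
  qed
  have "continuous_extension \<Omega> ((deriv ^^ 0) f) f"
    using assms by (simp add: A_space_def continuous_extension_def)
  then have "f \<in> Ap_space (enat (Suc n)) \<Omega> \<longleftrightarrow>
      (\<forall>l\<le>n. \<exists>g. continuous_extension \<Omega> ((deriv ^^ Suc l) f) g)"
    using holf unfolding Ap_space_def mem_Collect_eq enat_ord_simps all_le_Suc_iff by blast
  moreover have "\<exists>f'. continuous_extension \<Omega> (deriv f) f'"
    if "\<forall>l\<le>n. \<exists>g. continuous_extension \<Omega> ((deriv ^^ Suc l) f) g"
    using that[rule_format, of 0] by simp
  ultimately show ?thesis using * by blast
qed

text \<open>Pointwise limits suffice: if \<open>h\<close> is within \<open>e / 2\<close> of
  \<open>g \<xi>\<close> on the part of \<open>\<Omega>\<close> near \<open>\<xi>\<close>, then so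
  are the limits \<open>g \<eta>\<close> at nearby points \<open>\<eta>\<close> of the
  closure.\<close>

lemma continuous_extension_exists:
  fixes h :: "complex \<Rightarrow> complex"
  assumes "open \<Omega>" "continuous_on \<Omega> h"
    and lim: "\<And>\<xi>. \<xi> \<in> frontier \<Omega> \<Longrightarrow> \<exists>L. (h \<longlongrightarrow> L) (at \<xi> within \<Omega>)"
  obtains g where "continuous_extension \<Omega> h g"
proof -
  have "\<exists>L. (h \<longlongrightarrow> L) (at \<xi> within \<Omega>) \<and> (\<xi> \<in> \<Omega> \<longrightarrow> L = h \<xi>)" if "\<xi> \<in> closure \<Omega>" for \<xi>
  proof (cases "\<xi> \<in> \<Omega>")
    case True
    then show ?thesis using assms(2) by (auto simp: continuous_on_def)
  next
    case False
    then show ?thesis using lim[of \<xi>] that assms(1) by (auto simp: frontier_def interior_open)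
  qed
  then have "\<exists>g. \<forall>\<xi>\<in>closure \<Omega>. (h \<longlongrightarrow> g \<xi>) (at \<xi> within \<Omega>) \<and> (\<xi> \<in> \<Omega> \<longrightarrow> g \<xi> = h \<xi>)"
    by (intro bchoice) blast
  then obtain g where g0:
      "\<forall>\<xi>\<in>closure \<Omega>. (h \<longlongrightarrow> g \<xi>) (at \<xi> within \<Omega>) \<and> (\<xi> \<in> \<Omega> \<longrightarrow> g \<xi> = h \<xi>)" ..
  have g: "\<xi> \<in> closure \<Omega> \<Longrightarrow> (h \<longlongrightarrow> g \<xi>) (at \<xi> within \<Omega>)" "\<xi> \<in> \<Omega> \<Longrightarrow> g \<xi> = h \<xi>" for \<xi>
    using bspec[OF g0, of \<xi>] subsetD[OF closure_subset, of \<xi> \<Omega>] by blast+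
  have nt: "at \<xi> within \<Omega> \<noteq> bot" if "\<xi> \<in> closure \<Omega>" for \<xi>
  proof (cases "\<xi> \<in> \<Omega>")
    case True
    show ?thesis unfolding at_within_open[OF True assms(1)] by (rule at_neq_bot)
  next
    case False
    then show ?thesis using that by (simp add: closure_def trivial_limit_within)
  qed
  have "continuous_on (closure \<Omega>) g"
    unfolding continuous_on_iff
  proof (intro ballI allI impI)
    fix \<xi> and e :: real assume \<xi>: "\<xi> \<in> closure \<Omega>" and e: "0 < e"
    obtain d where d: "0 < d"
        "\<And>w. w \<in> \<Omega> \<Longrightarrow> w \<noteq> \<xi> \<Longrightarrow> dist w \<xi> < d \<Longrightarrow> dist (h w) (g \<xi>) < e / 2"
      using tendstoD[OF g(1)[OF \<xi>], of "e / 2"] e unfolding eventually_at by auto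
    have "dist (g \<eta>) (g \<xi>) < e" if \<eta>: "\<eta> \<in> closure \<Omega>" "dist \<eta> \<xi> < d" for \<eta>
    proof (cases "\<eta> = \<xi>")
      case False
      have "\<forall>\<^sub>F w in at \<eta> within \<Omega>. dist (h w) (g \<xi>) \<le> e / 2"
        unfolding eventually_at
      \<comment> \<open>The first bound keeps \<open>w\<close> within \<open>d\<close> of
        \<open>\<xi>\<close>; the second keeps \<open>w\<close> away from \<open>\<xi>\<close>
        itself, where the limit says nothing about \<open>h\<close>.\<close>
      proof (intro exI[of _ "min (d - dist \<eta> \<xi>) (dist \<eta> \<xi>)"] conjI ballI impI)
        fix w assume "w \<in> \<Omega>" "w \<noteq> \<eta> \<and> dist w \<eta> < min (d - dist \<eta> \<xi>) (dist \<eta> \<xi>)"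
        moreover have "dist w \<xi> \<le> dist w \<eta> + dist \<eta> \<xi>" by (rule dist_triangle)
        ultimately show "dist (h w) (g \<xi>) \<le> e / 2"
          using d(2)[of w] by (cases "w = \<xi>") (auto simp: dist_commute)
      qed (use \<eta> False in simp)
      then have "dist (g \<eta>) (g \<xi>) \<le> e / 2"
        by (rule tendsto_upperbound[OF tendsto_dist[OF g(1)[OF \<eta>(1)] tendsto_const] _ nt[OF \<eta>(1)]])
      then show ?thesis using e by simp
    qed (use e in simp)
    then show "\<exists>d>0. \<forall>\<eta>\<in>closure \<Omega>. dist \<eta> \<xi> < d \<longrightarrow> dist (g \<eta>) (g \<xi>) < e"
      using d(1) by blast
  qed
  then have "continuous_extension \<Omega> h g" using g(2) by (simp add: continuous_extension_def)
  then show thesis using that by blast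
qed

section \<open>Straightening the boundary\<close>

lemma bounded_by_analytic_Jordan_curve_extendable:
  assumes "bounded_by_analytic_Jordan_curve \<Omega> \<gamma>"
  shows "holomorphically_extendable \<gamma>"
  using assms real_analytic_imp_holomorphically_extendable
  by (auto simp: bounded_by_analytic_Jordan_curve_def)

text \<open>The complex extension of \<open>\<gamma>\<close> at \<open>s\<close> is injective near
  \<open>s\<close> because its derivative does not vanish. The rest of the curve is compact and
  misses \<open>\<gamma> s\<close>, so near this point the frontier is the image of real parameters
  close to \<open>s\<close>, and injectivity keeps nonreal points off it.\<close>

lemma local_chart:
  assumes \<gamma>: "bounded_by_analytic_Jordan_curve \<Omega> \<gamma>"
  obtains \<delta> \<Gamma> where "0 < \<delta>" "\<Gamma> holomorphic_on ball 0 \<delta>" "inj_on \<Gamma> (ball 0 \<delta>)"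
    "\<And>t. \<bar>t\<bar> < \<delta> \<Longrightarrow> \<Gamma> (of_real t) = \<gamma> (s + t)"
    "\<And>z. cmod z < \<delta> \<Longrightarrow> Im z \<noteq> 0 \<Longrightarrow> \<Gamma> z \<notin> frontier \<Omega>"
proof -
  obtain T where T: "0 < T" and per: "\<And>t. \<gamma> (t + T) = \<gamma> t" and inj: "\<And>a. inj_on \<gamma> {a..<a + T}"
    and ran: "range \<gamma> = frontier \<Omega>" and nz: "vector_derivative \<gamma> (at s) \<noteq> 0"
    using \<gamma> unfolding bounded_by_analytic_Jordan_curve_def by blast
  interpret periodic_fun_simple \<gamma> T
    by standard (rule per)
  note ext = bounded_by_analytic_Jordan_curve_extendable[OF \<gamma>]
  have cont: "continuous_on UNIV \<gamma>"
    using holomorphically_extendable_imp_C_real[OF ext, of 0] by (simp add: C_real_0_iff)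
  obtain \<delta>1 H where \<delta>1: "0 < \<delta>1" and H: "H holomorphic_on ball (complex_of_real s) \<delta>1"
    and \<gamma>H: "\<And>t. \<bar>t - s\<bar> < \<delta>1 \<Longrightarrow> \<gamma> t = H (of_real t)"
    using holomorphically_extendableE[OF ext, of s] by blast
  have "(\<gamma> has_vector_derivative deriv H (of_real s)) (at s)"
    by (rule has_vector_derivative_extension[OF H \<gamma>H]) (use \<delta>1 in auto)
  then have dH: "deriv H (of_real s) \<noteq> 0" using nz by (simp add: vector_derivative_at)
  have sb: "complex_of_real s \<in> ball (of_real s) \<delta>1" using \<delta>1 by simp
  obtain r where r: "0 < r" "ball (complex_of_real s) r \<subseteq> ball (of_real s) \<delta>1"
      "inj_on H (ball (complex_of_real s) r)"
    by (rule has_complex_derivative_locally_injective[OF H sb open_ball dH])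
  have r\<delta>: "r \<le> \<delta>1" using r by (auto simp: ball_subset_ball_iff)
  define \<rho> where "\<rho> = min r (T / 2)"
  have \<rho>: "0 < \<rho>" "\<rho> \<le> r" "\<rho> \<le> T / 2" using r T by (auto simp: \<rho>_def)
  \<comment> \<open>The parameters of one period at distance at least \<open>\<rho>\<close> from
    \<open>s\<close>. Both end points are kept for compactness; \<open>s + T/2\<close> lies outside
    the half-open interval of injectivity and is moved back by a period below.\<close>
  define C where "C = \<gamma> ` ({s - T/2..s - \<rho>} \<union> {s + \<rho>..s + T/2})"
  have "compact C"
    unfolding C_def
    by (intro compact_continuous_image continuous_on_subset[OF cont] compact_Un compact_Icc) auto
  then have "open (- C)" using compact_imp_closed by blast
  have inj': "t = t'" if "\<gamma> t = \<gamma> t'" "t \<in> {s - T/2..<s + T/2}" "t' \<in> {s - T/2..<s + T/2}" for t t'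
    using inj[of "s - T/2"] that by (auto simp: inj_on_def)
  have "\<gamma> s \<notin> C"
  proof
    assume "\<gamma> s \<in> C"
    then obtain t where t: "\<gamma> s = \<gamma> t" "t \<in> {s - T/2..s - \<rho>} \<union> {s + \<rho>..s + T/2}"
      unfolding C_def by blast
    show False
    proof (cases "t = s + T/2")
      case True
      then have "\<gamma> t = \<gamma> (s - T/2)" using per[of "s - T/2"] by (simp add: add.commute)
      then show False using inj'[of s "s - T/2"] t(1) T by simp
    next
      case False
      then show False using inj'[OF t(1)] t(2) T \<rho> by auto
    qed
  qed
  \<comment> \<open>Any parameter is moved by \<open>k\<close> periods into the interval about
    \<open>s\<close>; avoiding \<open>C\<close> then forces it close to \<open>s\<close>.\<close>
  have fr: "\<exists>t. \<bar>t - s\<bar> < \<rho> \<and> w = \<gamma> t" if w: "w \<in> frontier \<Omega>" "w \<notin> C" for w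
  proof -
    obtain t where t: "w = \<gamma> t" using w ran by blast
    define k where "k = \<lfloor>(t - (s - T/2)) / T\<rfloor>"
    define t' where "t' = t - of_int k * T"
    have "of_int k \<le> (t - (s - T/2)) / T" "(t - (s - T/2)) / T < of_int k + 1"
      unfolding k_def by linarith+
    then have t': "s - T/2 \<le> t'" "t' < s + T/2"
      using T by (auto simp: t'_def field_simps)
    have "w = \<gamma> t'" unfolding t t'_def by (simp add: minus_of_int)
    moreover from this have "t' \<notin> {s - T/2..s - \<rho>} \<union> {s + \<rho>..s + T/2}"
      using w(2) unfolding C_def by blast
    ultimately show ?thesis using t' by (intro exI[of _ t']) auto
  qed
  have "isCont H (of_real s)"
    using H \<delta>1 by (meson centre_in_ball continuous_on_eq_continuous_at holomorphic_on_imp_continuous_on open_ball)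
  then have "(H \<longlongrightarrow> \<gamma> s) (at (of_real s))"
    using \<gamma>H[of s] \<delta>1 by (simp add: isCont_def)
  then have "\<forall>\<^sub>F z in at (of_real s). H z \<in> - C"
    using \<open>open (- C)\<close> \<open>\<gamma> s \<notin> C\<close> by (intro topological_tendstoD) auto
  then obtain d where d: "0 < d" "\<And>z. z \<noteq> of_real s \<Longrightarrow> dist z (of_real s) < d \<Longrightarrow> H z \<notin> C"
    unfolding eventually_at by auto
  define \<delta> where "\<delta> = min d \<rho>"
  have \<delta>: "0 < \<delta>" "\<delta> \<le> d" "\<delta> \<le> r" "\<delta> \<le> \<delta>1" using d \<rho> r\<delta> by (auto simp: \<delta>_def)
  define \<Gamma> where "\<Gamma> = (\<lambda>z. H (of_real s + z))"
  have shift: "of_real s + z \<in> ball (complex_of_real s) e \<longleftrightarrow> cmod z < e" for z e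
    by (simp add: dist_norm)
  show thesis
  proof
    show "0 < \<delta>" by fact
    have "(H \<circ> (+) (of_real s)) holomorphic_on ball 0 \<delta>"
      by (intro holomorphic_on_compose_gen[OF _ H] holomorphic_intros)
         (use \<delta> in \<open>auto simp: dist_norm\<close>)
    then show "\<Gamma> holomorphic_on ball 0 \<delta>" by (simp add: \<Gamma>_def o_def)
    show "inj_on \<Gamma> (ball 0 \<delta>)"
    proof (rule inj_onI)
      fix x y assume "x \<in> ball 0 \<delta>" "y \<in> ball 0 \<delta>" "\<Gamma> x = \<Gamma> y"
      then show "x = y"
        using inj_onD[OF r(3), of "of_real s + x" "of_real s + y"] shift \<delta> by (simp add: \<Gamma>_def)
    qed
    show "\<Gamma> (of_real t) = \<gamma> (s + t)" if "\<bar>t\<bar> < \<delta>" for t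
      using \<gamma>H[of "s + t"] that \<delta> by (simp add: \<Gamma>_def)
    show "\<Gamma> z \<notin> frontier \<Omega>" if z: "cmod z < \<delta>" "Im z \<noteq> 0" for z
    proof
      assume *: "\<Gamma> z \<in> frontier \<Omega>"
      have "z \<noteq> 0" using z by auto
      then have "\<Gamma> z \<notin> C"
        using d(2)[of "of_real s + z"] z \<delta> by (simp add: \<Gamma>_def dist_norm)
      then obtain t where t: "\<bar>t - s\<bar> < \<rho>" "\<Gamma> z = \<gamma> t" using fr[OF *] by blast
      then have "H (of_real s + z) = H (of_real t)"
        using \<gamma>H[of t] \<rho> r\<delta> by (simp add: \<Gamma>_def)
      moreover have "of_real s + z \<in> ball (complex_of_real s) r" using z \<delta> shift by simp
      moreover have "of_real t \<in> ball (complex_of_real s) r"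
        using t \<rho> by (simp add: dist_real_def abs_minus_commute)
      ultimately have "of_real s + z = of_real t" using inj_onD[OF r(3)] by blast
      then have "Im (of_real s + z) = 0" by simp
      then show False using z by simp
    qed
  qed
qed

text \<open>A chart straightening the boundary near \<open>\<gamma> s\<close> and mapping the upper half disc into \<open>\<Omega>\<close>;
  \<open>\<sigma> = 1\<close> or \<open>\<sigma> = - 1\<close> depending on the side of \<open>\<gamma>\<close> on which \<open>\<Omega>\<close> lies.\<close>

definition half_chart ::
    "complex set \<Rightarrow> (real \<Rightarrow> complex) \<Rightarrow> real \<Rightarrow> real \<Rightarrow> real \<Rightarrow> (complex \<Rightarrow> complex) \<Rightarrow> bool" where
  "half_chart \<Omega> \<gamma> s \<sigma> \<delta> \<Phi> \<longleftrightarrow> \<sigma> \<in> {1, - 1} \<and> 0 < \<delta> \<and> \<Phi> holomorphic_on ball 0 \<delta> \<and>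
     (\<forall>z\<in>ball 0 \<delta>. deriv \<Phi> z \<noteq> 0) \<and>
     (\<forall>t. \<bar>t\<bar> < \<delta> \<longrightarrow> \<Phi> (of_real t) = \<gamma> (s + \<sigma> * t)) \<and>
     (\<forall>z\<in>ball 0 \<delta>. 0 < Im z \<longrightarrow> \<Phi> z \<in> \<Omega>)"

text \<open>One point of the half disc that is sent into \<open>\<Omega>\<close> suffices, because
  the image is connected and misses the frontier. For \<open>\<sigma> = - 1\<close> the half turn
  exchanges the two half discs and reverses the real axis.\<close>

lemma half_chartI:
  assumes "0 < \<delta>" "\<Gamma> holomorphic_on ball 0 \<delta>" "inj_on \<Gamma> (ball 0 \<delta>)"
    and "\<And>t. \<bar>t\<bar> < \<delta> \<Longrightarrow> \<Gamma> (of_real t) = \<gamma> (s + t)"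
    and fr: "\<And>z. cmod z < \<delta> \<Longrightarrow> Im z \<noteq> 0 \<Longrightarrow> \<Gamma> z \<notin> frontier \<Omega>"
    and \<sigma>: "\<sigma> \<in> {1, - 1}"
    and z: "cmod z < \<delta>" "0 < Im z" "\<Gamma> (of_real \<sigma> * z) \<in> \<Omega>"
  shows "half_chart \<Omega> \<gamma> s \<sigma> \<delta> (\<lambda>z. \<Gamma> (of_real \<sigma> * z))"
proof -
  define \<Phi> where "\<Phi> = (\<lambda>z. \<Gamma> (of_real \<sigma> * z))"
  have ab: "cmod (of_real \<sigma> * z) = cmod z" for z using \<sigma> by (auto simp: norm_mult)
  have "(\<Gamma> \<circ> (*) (of_real \<sigma>)) holomorphic_on ball 0 \<delta>"
    by (intro holomorphic_on_compose_gen[OF _ assms(2)] holomorphic_intros) (auto simp: ab)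
  then have hol: "\<Phi> holomorphic_on ball 0 \<delta>" by (simp add: \<Phi>_def o_def)
  have inj: "inj_on \<Phi> (ball 0 \<delta>)"
  proof (rule inj_onI)
    fix x y assume "x \<in> ball 0 \<delta>" "y \<in> ball 0 \<delta>" "\<Phi> x = \<Phi> y"
    then have "of_real \<sigma> * x = of_real \<sigma> * y"
      by (intro inj_onD[OF assms(3), of "of_real \<sigma> * x" "of_real \<sigma> * y"]) (auto simp: \<Phi>_def ab)
    then show "x = y" using \<sigma> by auto
  qed
  have nz: "deriv \<Phi> w \<noteq> 0" if "w \<in> ball 0 \<delta>" for w
    using holomorphic_injective_imp_regular[OF hol open_ball inj that] .
  define S where "S = {z. cmod z < \<delta> \<and> 0 < Im z}"
  have "connected (\<Phi> ` S)"
  proof (rule connected_continuous_image)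
    show "continuous_on S \<Phi>"
      by (rule continuous_on_subset[OF holomorphic_on_imp_continuous_on[OF hol]]) (auto simp: S_def)
    show "connected S" unfolding S_def by (intro convex_connected convex_half_disc)
  qed
  moreover have "\<Phi> ` S \<inter> frontier \<Omega> = {}"
  proof -
    have "\<Phi> w \<notin> frontier \<Omega>" if "w \<in> S" for w
      unfolding \<Phi>_def using that \<sigma> by (intro fr) (auto simp: S_def ab)
    then show ?thesis by blast
  qed
  moreover have "\<Phi> z \<in> \<Phi> ` S \<inter> \<Omega>" using z by (auto simp: S_def \<Phi>_def)
  ultimately have "\<Phi> ` S \<subseteq> \<Omega>" using connected_Int_frontier[of "\<Phi> ` S" \<Omega>] by blast
  then have "\<Phi> w \<in> \<Omega>" if "w \<in> ball 0 \<delta>" "0 < Im w" for w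
    using that by (auto simp: S_def)
  moreover have "\<Phi> (of_real t) = \<gamma> (s + \<sigma> * t)" if "\<bar>t\<bar> < \<delta>" for t
    using assms(4)[of "\<sigma> * t"] that \<sigma> by (auto simp: \<Phi>_def)
  ultimately have "half_chart \<Omega> \<gamma> s \<sigma> \<delta> \<Phi>"
    unfolding half_chart_def using \<sigma> assms(1) hol nz by blast
  then show ?thesis by (simp add: \<Phi>_def)
qed

lemma open_image_ball:
  assumes "\<Gamma> holomorphic_on ball 0 \<delta>" "inj_on \<Gamma> (ball 0 \<delta>)" "\<eta> \<le> \<delta>"
  shows "open (\<Gamma> ` ball 0 \<eta>)"
proof (rule open_mapping_thm3)
  have "ball 0 \<eta> \<subseteq> ball (0::complex) \<delta>" using assms by auto
  then show "\<Gamma> holomorphic_on ball 0 \<eta>" "inj_on \<Gamma> (ball 0 \<eta>)"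
    using assms holomorphic_on_subset inj_on_subset by blast+
qed simp

text \<open>A small neighbourhood of \<open>\<gamma> s\<close> in \<open>\<Omega>\<close> is covered by half charts. There might be two of them:
  that \<open>\<Omega>\<close> lies on one side of \<open>\<gamma>\<close> only is never needed.\<close>

lemma half_chart_cover:
  assumes \<gamma>: "bounded_by_analytic_Jordan_curve \<Omega> \<gamma>" and "open \<Omega>"
  shows "\<exists>\<delta> \<Phi>. \<forall>\<eta>>0. \<exists>U. open U \<and> \<gamma> s \<in> U \<and> (\<forall>w\<in>U \<inter> \<Omega>.
       \<exists>\<sigma>\<in>{1, - 1}. half_chart \<Omega> \<gamma> s \<sigma> \<delta> (\<Phi> \<sigma>) \<and> (\<exists>z. cmod z < \<eta> \<and> 0 < Im z \<and> w = \<Phi> \<sigma> z))"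
proof -
  obtain \<delta> \<Gamma> where \<Gamma>: "0 < \<delta>" "\<Gamma> holomorphic_on ball 0 \<delta>" "inj_on \<Gamma> (ball 0 \<delta>)"
    "\<And>t. \<bar>t\<bar> < \<delta> \<Longrightarrow> \<Gamma> (of_real t) = \<gamma> (s + t)"
    "\<And>z. cmod z < \<delta> \<Longrightarrow> Im z \<noteq> 0 \<Longrightarrow> \<Gamma> z \<notin> frontier \<Omega>"
    using local_chart[OF \<gamma>, of s] by blast
  have ran: "range \<gamma> = frontier \<Omega>" using \<gamma> by (simp add: bounded_by_analytic_Jordan_curve_def)
  define \<Phi> where "\<Phi> = (\<lambda>\<sigma> z. \<Gamma> (complex_of_real \<sigma> * z))"
  have "\<exists>U. open U \<and> \<gamma> s \<in> U \<and> (\<forall>w\<in>U \<inter> \<Omega>. \<exists>\<sigma>\<in>{1, - 1}. half_chart \<Omega> \<gamma> s \<sigma> \<delta> (\<Phi> \<sigma>) \<and>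
      (\<exists>z. cmod z < \<eta> \<and> 0 < Im z \<and> w = \<Phi> \<sigma> z))" if "0 < \<eta>" for \<eta>
  proof (intro exI conjI ballI)
    define e where "e = min \<eta> \<delta>"
    have e: "0 < e" "e \<le> \<eta>" "e \<le> \<delta>" using that \<Gamma>(1) by (auto simp: e_def)
    show "open (\<Gamma> ` ball 0 e)" using \<Gamma> e by (intro open_image_ball)
    show "\<gamma> s \<in> \<Gamma> ` ball 0 e" using \<Gamma>(4)[of 0] \<Gamma>(1) e by (intro image_eqI[of _ _ 0]) auto
    fix w assume "w \<in> \<Gamma> ` ball 0 e \<inter> \<Omega>"
    then obtain z where z: "cmod z < e" "w = \<Gamma> z" "\<Gamma> z \<in> \<Omega>" by auto
    have "\<Gamma> z \<notin> frontier \<Omega>" using z(3) \<open>open \<Omega>\<close> by (simp add: frontier_def interior_open)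
    have "Im z \<noteq> 0"
    proof
      assume "Im z = 0"
      then obtain t where t: "z = of_real t" by (metis complex_is_Real_iff Reals_cases)
      then have "\<Gamma> z = \<gamma> (s + t)" using \<Gamma>(4)[of t] z e by simp
      then show False using \<open>\<Gamma> z \<notin> frontier \<Omega>\<close> ran by auto
    qed
    \<comment> \<open>The sign selects the half disc that contains \<open>z\<close>; multiplying by
      it moves \<open>z\<close> into the upper one.\<close>
    define \<sigma> where "\<sigma> = sgn (Im z)"
    have \<sigma>: "\<sigma> \<in> {1, - 1}" "\<sigma> * \<sigma> = 1" "0 < \<sigma> * Im z"
      using \<open>Im z \<noteq> 0\<close> by (auto simp: \<sigma>_def sgn_if)
    define z' where "z' = of_real \<sigma> * z"
    have "of_real \<sigma> * z' = of_real (\<sigma> * \<sigma>) * z" by (simp add: z'_def)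
    then have z': "cmod z' = cmod z" "0 < Im z'" "of_real \<sigma> * z' = z"
      using \<sigma> by (auto simp: z'_def norm_mult)
    have "half_chart \<Omega> \<gamma> s \<sigma> \<delta> (\<Phi> \<sigma>)"
      unfolding \<Phi>_def by (rule half_chartI[OF \<Gamma> \<sigma>(1), of z']) (use z z' e in auto)
    then show "\<exists>\<sigma>\<in>{1, - 1}. half_chart \<Omega> \<gamma> s \<sigma> \<delta> (\<Phi> \<sigma>) \<and>
        (\<exists>z. cmod z < \<eta> \<and> 0 < Im z \<and> w = \<Phi> \<sigma> z)"
      using \<sigma>(1) z z' e unfolding \<Phi>_def by (intro bexI[of _ \<sigma>] conjI exI[of _ z']) auto
  qed
  then show ?thesis by blast
qed

text \<open>\<open>\<gamma> s\<close> is in the closure of \<open>\<Omega>\<close>, so the covered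
  neighbourhood meets \<open>\<Omega>\<close>, and any common point yields a chart.\<close>

lemma half_chart_exists:
  assumes \<gamma>: "bounded_by_analytic_Jordan_curve \<Omega> \<gamma>" and "open \<Omega>"
  obtains \<sigma> \<delta> \<Phi> where "half_chart \<Omega> \<gamma> s \<sigma> \<delta> \<Phi>"
proof -
  obtain \<delta> \<Phi> where cover: "\<forall>\<eta>>0. \<exists>U. open U \<and> \<gamma> s \<in> U \<and> (\<forall>w\<in>U \<inter> \<Omega>.
       \<exists>\<sigma>\<in>{1, - 1}. half_chart \<Omega> \<gamma> s \<sigma> \<delta> (\<Phi> \<sigma>) \<and> (\<exists>z. cmod z < \<eta> \<and> 0 < Im z \<and> w = \<Phi> \<sigma> z))"
    using half_chart_cover[OF assms, of s] by (elim exE)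
  obtain U where U: "open U" "\<gamma> s \<in> U" "\<forall>w\<in>U \<inter> \<Omega>. \<exists>\<sigma>\<in>{1, - 1}. half_chart \<Omega> \<gamma> s \<sigma> \<delta> (\<Phi> \<sigma>) \<and> (\<exists>z. cmod z < 1 \<and> 0 < Im z \<and> w = \<Phi> \<sigma> z)"
    using cover[rule_format, of 1] by auto
  have "range \<gamma> = frontier \<Omega>" using \<gamma> by (simp add: bounded_by_analytic_Jordan_curve_def)
  then have "\<gamma> s \<in> closure \<Omega>" unfolding frontier_def by blast
  then have "U \<inter> \<Omega> \<noteq> {}" using U open_Int_closure_eq_empty[of U \<Omega>] by blast
  then show thesis using U(3) that by blast
qed

text \<open>\<open>half_chart_cover\<close> fixes \<open>\<delta>\<close> and \<open>\<Phi>\<close>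
  before \<open>\<eta>\<close>, so at most two charts occur and the smaller of two radii serves
  both. Their limits have to agree, hence the same \<open>L\<close> for all charts.\<close>

lemma tendsto_within_half_charts:
  assumes \<gamma>: "bounded_by_analytic_Jordan_curve \<Omega> \<gamma>" and "open \<Omega>"
    and lim: "\<And>\<sigma> \<delta> \<Phi>. half_chart \<Omega> \<gamma> s \<sigma> \<delta> \<Phi> \<Longrightarrow>
      ((\<lambda>z. h (\<Phi> z)) \<longlongrightarrow> L) (at 0 within {z. 0 < Im z})"
  shows "(h \<longlongrightarrow> L) (at (\<gamma> s) within \<Omega>)"
proof (rule topological_tendstoI)
  fix V assume V: "open V" "L \<in> V"
  obtain \<delta> \<Phi> where cover: "\<forall>\<eta>>0. \<exists>U. open U \<and> \<gamma> s \<in> U \<and> (\<forall>w\<in>U \<inter> \<Omega>.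
       \<exists>\<sigma>\<in>{1, - 1}. half_chart \<Omega> \<gamma> s \<sigma> \<delta> (\<Phi> \<sigma>) \<and> (\<exists>z. cmod z < \<eta> \<and> 0 < Im z \<and> w = \<Phi> \<sigma> z))"
    using half_chart_cover[OF assms(1,2), of s] by (elim exE)
  \<comment> \<open>If \<open>\<Phi> \<sigma>\<close> is no half chart, the radius 1 is a dummy
    value that makes the choice of \<open>\<eta>\<close> total in \<open>\<sigma>\<close>.\<close>
  have "\<exists>\<eta>>0. half_chart \<Omega> \<gamma> s \<sigma> \<delta> (\<Phi> \<sigma>) \<longrightarrow> (\<forall>z. cmod z < \<eta> \<and> 0 < Im z \<longrightarrow> h (\<Phi> \<sigma> z) \<in> V)" for \<sigma>
  proof (cases "half_chart \<Omega> \<gamma> s \<sigma> \<delta> (\<Phi> \<sigma>)")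
    case True
    then obtain \<eta> where \<eta>: "0 < \<eta>" "\<forall>z\<in>{z. 0 < Im z}. z \<noteq> 0 \<and> dist z 0 < \<eta> \<longrightarrow> h (\<Phi> \<sigma> z) \<in> V"
      using topological_tendstoD[OF lim V] unfolding eventually_at by blast
    have "h (\<Phi> \<sigma> z) \<in> V" if "cmod z < \<eta>" "0 < Im z" for z
    proof -
      have "z \<noteq> 0" using that by auto
      then show ?thesis using bspec[OF \<eta>(2), of z] that by simp
    qed
    then show ?thesis using \<eta>(1) by blast
  qed (auto intro: exI[of _ 1])
  then obtain \<eta> where \<eta>: "\<And>\<sigma>. 0 < \<eta> \<sigma>" "\<And>\<sigma> z. half_chart \<Omega> \<gamma> s \<sigma> \<delta> (\<Phi> \<sigma>) \<Longrightarrow>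
      cmod z < \<eta> \<sigma> \<Longrightarrow> 0 < Im z \<Longrightarrow> h (\<Phi> \<sigma> z) \<in> V"
    by metis
  have "0 < min (\<eta> 1) (\<eta> (- 1))" using \<eta>(1) by simp
  with cover obtain U where U: "open U" "\<gamma> s \<in> U" "\<forall>w\<in>U \<inter> \<Omega>. \<exists>\<sigma>\<in>{1, - 1}. half_chart \<Omega> \<gamma> s \<sigma> \<delta> (\<Phi> \<sigma>) \<and>
      (\<exists>z. cmod z < min (\<eta> 1) (\<eta> (- 1)) \<and> 0 < Im z \<and> w = \<Phi> \<sigma> z)"
    by blast
  have "h w \<in> V" if w: "w \<in> U" "w \<in> \<Omega>" for w
  proof -
    obtain \<sigma> z where "\<sigma> \<in> {1, - 1}" "half_chart \<Omega> \<gamma> s \<sigma> \<delta> (\<Phi> \<sigma>)"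
        "cmod z < min (\<eta> 1) (\<eta> (- 1))" "0 < Im z" "w = \<Phi> \<sigma> z"
      using U(3) w by blast
    then show ?thesis using \<eta>(2)[of \<sigma> z] by auto
  qed
  then show "\<forall>\<^sub>F w in at (\<gamma> s) within \<Omega>. h w \<in> V"
    unfolding eventually_at_topological using U by blast
qed

section \<open>Boundary derivatives seen through a half chart\<close>

context
  fixes \<Omega> :: "complex set" and \<gamma> :: "real \<Rightarrow> complex" and s \<sigma> \<delta> :: real and \<Phi> F :: "complex \<Rightarrow> complex"
  assumes \<gamma>: "bounded_by_analytic_Jordan_curve \<Omega> \<gamma>" and "open \<Omega>"
    and chart: "half_chart \<Omega> \<gamma> s \<sigma> \<delta> \<Phi>"
    and F: "F \<in> A_space \<Omega>"
begin

text \<open>On the real axis \<open>\<Phi>\<close> runs through \<open>\<gamma>\<close> with speed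
  \<open>\<sigma>\<close>, and the complex derivative can be computed along that axis.\<close>

lemma half_chart_deriv: "deriv \<Phi> 0 = of_real \<sigma> * vector_derivative \<gamma> (at s)"
proof -
  have "(\<Phi> has_field_derivative deriv \<Phi> 0) (at (of_real 0))"
    using chart by (auto simp: half_chart_def intro!: holomorphic_derivI[of _ "ball 0 \<delta>"])
  then have "((\<lambda>t. \<Phi> (of_real t)) has_vector_derivative deriv \<Phi> 0) (at 0)"
    by (rule has_vector_derivative_real_field)
  then have 1: "((\<lambda>t. \<gamma> (s + \<sigma> * t)) has_vector_derivative deriv \<Phi> 0) (at 0)"
    by (rule has_vector_derivative_transform_within_open[where S = "ball 0 \<delta>"])
       (use chart in \<open>auto simp: half_chart_def\<close>)
  have "((\<lambda>t. s + \<sigma> * t) has_vector_derivative \<sigma>) (at 0)"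
    by (auto intro!: derivative_eq_intros simp flip: has_real_derivative_iff_has_vector_derivative)
  moreover have "(\<gamma> has_vector_derivative vector_derivative \<gamma> (at s)) (at (s + \<sigma> * 0))"
    using holomorphically_extendable_has_vector_derivative[OF
        bounded_by_analytic_Jordan_curve_extendable[OF \<gamma>], of s] by simp
  ultimately have "(\<gamma> \<circ> (\<lambda>t. s + \<sigma> * t) has_vector_derivative \<sigma> *\<^sub>R vector_derivative \<gamma> (at s)) (at 0)"
    by (rule vector_diff_chain_at)
  with 1 show ?thesis
    by (simp add: o_def vector_derivative_unique_at scaleR_conv_of_real)
qed

text \<open>Supplies the hypotheses of the half disc lemmas for \<open>F \<circ> \<Phi>\<close>: the
  diameter goes to the frontier and the open half disc into \<open>\<Omega>\<close>.\<close>

lemma half_chart_pullback: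
  shows "continuous_on {z. cmod z < \<delta> \<and> 0 \<le> Im z} (\<lambda>z. F (\<Phi> z))"
    and "(\<lambda>z. F (\<Phi> z)) holomorphic_on {z. cmod z < \<delta> \<and> 0 < Im z}"
    and "\<And>z. cmod z < \<delta> \<Longrightarrow> 0 < Im z \<Longrightarrow> deriv (\<lambda>z. F (\<Phi> z)) z = deriv F (\<Phi> z) * deriv \<Phi> z"
proof -
  have hol\<Phi>: "\<Phi> holomorphic_on ball 0 \<delta>" and in\<Omega>: "\<And>z. cmod z < \<delta> \<Longrightarrow> 0 < Im z \<Longrightarrow> \<Phi> z \<in> \<Omega>"
    and real: "\<And>t. \<bar>t\<bar> < \<delta> \<Longrightarrow> \<Phi> (of_real t) = \<gamma> (s + \<sigma> * t)"
    using chart by (auto simp: half_chart_def)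
  have holF: "F holomorphic_on \<Omega>" and contF: "continuous_on (closure \<Omega>) F"
    using F by (auto simp: A_space_def)
  have "\<Phi> z \<in> closure \<Omega>" if z: "cmod z < \<delta>" "0 \<le> Im z" for z
  proof (cases "Im z = 0")
    case True
    then obtain t where t: "z = of_real t" by (metis complex_is_Real_iff Reals_cases)
    then have "\<Phi> z = \<gamma> (s + \<sigma> * t)" using real[of t] z by simp
    moreover have "range \<gamma> = frontier \<Omega>" using \<gamma> by (simp add: bounded_by_analytic_Jordan_curve_def)
    ultimately show ?thesis unfolding frontier_def by blast
  next
    case False
    then show ?thesis using in\<Omega>[of z] z closure_subset[of \<Omega>] by auto
  qed
  then show "continuous_on {z. cmod z < \<delta> \<and> 0 \<le> Im z} (\<lambda>z. F (\<Phi> z))"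
    by (intro continuous_on_compose2[OF contF]
          continuous_on_subset[OF holomorphic_on_imp_continuous_on[OF hol\<Phi>]]) auto
  have "(F \<circ> \<Phi>) holomorphic_on {z. cmod z < \<delta> \<and> 0 < Im z}"
    by (intro holomorphic_on_compose_gen[OF holomorphic_on_subset[OF hol\<Phi>] holF]) (auto intro: in\<Omega>)
  then show "(\<lambda>z. F (\<Phi> z)) holomorphic_on {z. cmod z < \<delta> \<and> 0 < Im z}" by (simp add: o_def)
  show "deriv (\<lambda>z. F (\<Phi> z)) z = deriv F (\<Phi> z) * deriv \<Phi> z" if z: "cmod z < \<delta>" "0 < Im z" for z
  proof -
    have "(F has_field_derivative deriv F (\<Phi> z)) (at (\<Phi> z))"
      using holomorphic_derivI[OF holF \<open>open \<Omega>\<close>] in\<Omega> z by blast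
    moreover have "(\<Phi> has_field_derivative deriv \<Phi> z) (at z)"
      by (rule holomorphic_derivI[OF hol\<Phi> open_ball]) (use z in simp)
    ultimately have "(F \<circ> \<Phi> has_field_derivative deriv F (\<Phi> z) * deriv \<Phi> z) (at z)"
      by (rule DERIV_chain)
    then show ?thesis by (intro DERIV_imp_deriv) (simp add: o_def)
  qed
qed

lemma half_chart_tendsto_deriv: "(deriv \<Phi> \<longlongrightarrow> deriv \<Phi> 0) (at 0 within S)"
proof -
  have "deriv \<Phi> holomorphic_on ball 0 \<delta>"
    using chart by (intro holomorphic_deriv) (auto simp: half_chart_def)
  then have "isCont (deriv \<Phi>) 0"
    using chart by (intro continuous_on_interior[OF holomorphic_on_imp_continuous_on])
      (auto simp: half_chart_def interior_open)
  then show ?thesis unfolding isCont_def by (rule tendsto_within_subset) simp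
qed

lemma eventually_half_disc: "\<forall>\<^sub>F z in at 0 within {z. 0 < Im z}. cmod z < \<delta> \<and> 0 < Im z"
  unfolding eventually_at using chart by (intro exI[of _ \<delta>]) (auto simp: half_chart_def)

text \<open>By the chain rule the derivative of the pullback is
  \<open>F' (\<Phi> z) * deriv \<Phi> z\<close>, which has a limit at 0. By
  \<open>has_vector_derivative_boundary\<close> this limit is the derivative along the real
  axis.\<close>

lemma half_chart_forward:
  assumes F': "continuous_extension \<Omega> (deriv F) F'"
  shows "((F \<circ> \<gamma>) has_vector_derivative F' (\<gamma> s) * vector_derivative \<gamma> (at s)) (at s)"
proof -
  have \<sigma>: "\<sigma> * \<sigma> = 1" and \<delta>: "0 < \<delta>" and real: "\<And>t. \<bar>t\<bar> < \<delta> \<Longrightarrow> \<Phi> (of_real t) = \<gamma> (s + \<sigma> * t)"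
    using chart by (auto simp: half_chart_def)
  have "\<Phi> 0 = \<gamma> s" using real[of 0] \<delta> by simp
  have "((\<lambda>z. F' (\<Phi> z)) \<longlongrightarrow> F' (\<Phi> 0)) (at 0 within {z. 0 < Im z})"
  proof (rule continuous_on_tendsto_compose[of "closure \<Omega>" F' \<Phi> "\<Phi> 0"])
    show "continuous_on (closure \<Omega>) F'" using F' by (simp add: continuous_extension_def)
    have "isCont \<Phi> 0"
      using chart by (intro continuous_on_interior[OF holomorphic_on_imp_continuous_on[of _ "ball 0 \<delta>"]])
        (auto simp: half_chart_def interior_open)
    then show "(\<Phi> \<longlongrightarrow> \<Phi> 0) (at 0 within {z. 0 < Im z})"
      unfolding isCont_def by (rule tendsto_within_subset) simp
    have "range \<gamma> = frontier \<Omega>" using \<gamma> by (simp add: bounded_by_analytic_Jordan_curve_def)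
    then show "\<Phi> 0 \<in> closure \<Omega>" unfolding \<open>\<Phi> 0 = \<gamma> s\<close> frontier_def by blast
    show "\<forall>\<^sub>F z in at 0 within {z. 0 < Im z}. \<Phi> z \<in> closure \<Omega>"
      using eventually_half_disc
      by eventually_elim (use chart closure_subset[of \<Omega>] in \<open>auto simp: half_chart_def\<close>)
  qed
  then have "((\<lambda>z. F' (\<Phi> z) * deriv \<Phi> z) \<longlongrightarrow> F' (\<Phi> 0) * deriv \<Phi> 0) (at 0 within {z. 0 < Im z})"
    by (intro tendsto_mult half_chart_tendsto_deriv)
  moreover have "\<forall>\<^sub>F z in at 0 within {z. 0 < Im z}. F' (\<Phi> z) * deriv \<Phi> z = deriv (\<lambda>z. F (\<Phi> z)) z"
    using eventually_half_disc
    by eventually_elim (use chart F' in \<open>auto simp: half_chart_pullback(3) half_chart_def continuous_extension_def\<close>)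
  ultimately have "(deriv (\<lambda>z. F (\<Phi> z)) \<longlongrightarrow> F' (\<Phi> 0) * deriv \<Phi> 0) (at 0 within {z. 0 < Im z})"
    by (rule Lim_transform_eventually)
  then have "((\<lambda>t. F (\<Phi> (of_real t))) has_vector_derivative F' (\<Phi> 0) * deriv \<Phi> 0) (at 0)"
    by (rule has_vector_derivative_boundary[OF \<delta> half_chart_pullback(1,2)])
  then have "((\<lambda>t. F (\<gamma> (s + \<sigma> * t))) has_vector_derivative F' (\<Phi> 0) * deriv \<Phi> 0) (at 0)"
    by (rule has_vector_derivative_transform_within_open[where S = "ball 0 \<delta>"])
       (use \<delta> real in auto)
  then have 1: "((\<lambda>t. F (\<gamma> (s + \<sigma> * t))) has_vector_derivative F' (\<Phi> 0) * deriv \<Phi> 0) (at (\<sigma> * (s - s)))"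
    by simp
  \<comment> \<open>As \<open>\<sigma> * \<sigma> = 1\<close>, this map inverts the parameter change
    \<open>s + \<sigma> * t\<close> of the chart; the factor \<open>\<sigma>\<close> it contributes
    cancels the one in \<open>deriv \<Phi> 0\<close>.\<close>
  have "((\<lambda>t. \<sigma> * (t - s)) has_vector_derivative \<sigma>) (at s)"
    by (auto intro!: derivative_eq_intros simp flip: has_real_derivative_iff_has_vector_derivative)
  from vector_diff_chain_at[OF this 1]
  have "((\<lambda>t. F (\<gamma> (s + \<sigma> * (\<sigma> * (t - s))))) has_vector_derivative \<sigma> *\<^sub>R (F' (\<Phi> 0) * deriv \<Phi> 0)) (at s)"
    by (simp add: o_def)
  moreover have "s + \<sigma> * (\<sigma> * (t - s)) = t" for t
    using \<sigma> by (simp flip: mult.assoc)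
  moreover have "\<sigma> *\<^sub>R (F' (\<Phi> 0) * deriv \<Phi> 0) = of_real (\<sigma> * \<sigma>) * (F' (\<gamma> s) * vector_derivative \<gamma> (at s))"
    unfolding half_chart_deriv \<open>\<Phi> 0 = \<gamma> s\<close> by (simp add: scaleR_conv_of_real)
  ultimately show ?thesis by (simp add: o_def \<sigma>)
qed

text \<open>\<open>deriv_tendsto_boundary\<close> gives the limit of the derivative of the pullback,
  and dividing by \<open>deriv \<Phi>\<close>, nonzero at 0, recovers \<open>deriv F\<close>. The
  sign \<open>\<sigma>\<close> cancels, so charts on both sides of \<open>\<gamma>\<close> give the
  same limit.\<close>

lemma half_chart_backward:
  assumes h': "\<And>t. ((F \<circ> \<gamma>) has_vector_derivative h' t) (at t)" and cont: "continuous_on UNIV h'"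
  shows "((\<lambda>z. deriv F (\<Phi> z)) \<longlongrightarrow> h' s / vector_derivative \<gamma> (at s)) (at 0 within {z. 0 < Im z})"
proof -
  have \<sigma>: "\<sigma> * \<sigma> = 1" "\<sigma> \<noteq> 0" and \<delta>: "0 < \<delta>"
    and real: "\<And>t. \<bar>t\<bar> < \<delta> \<Longrightarrow> \<Phi> (of_real t) = \<gamma> (s + \<sigma> * t)" and nz: "deriv \<Phi> 0 \<noteq> 0"
    using chart by (auto simp: half_chart_def)
  have "(deriv (\<lambda>z. F (\<Phi> z)) \<longlongrightarrow> \<sigma> *\<^sub>R h' (s + \<sigma> * 0)) (at 0 within {z. 0 < Im z})"
  proof (rule deriv_tendsto_boundary[OF \<delta> half_chart_pullback(1,2)])
    fix t :: real assume t: "\<bar>t\<bar> < \<delta>"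
    have "((\<lambda>t. s + \<sigma> * t) has_vector_derivative \<sigma>) (at t)"
      by (auto intro!: derivative_eq_intros simp flip: has_real_derivative_iff_has_vector_derivative)
    then have "((F \<circ> \<gamma>) \<circ> (\<lambda>t. s + \<sigma> * t) has_vector_derivative \<sigma> *\<^sub>R h' (s + \<sigma> * t)) (at t)"
      by (rule vector_diff_chain_at) (rule h')
    then show "((\<lambda>t. F (\<Phi> (of_real t))) has_vector_derivative \<sigma> *\<^sub>R h' (s + \<sigma> * t)) (at t)"
      by (rule has_vector_derivative_transform_within_open[where S = "ball 0 \<delta>"])
         (use t real in auto)
  next
    show "isCont (\<lambda>t. \<sigma> *\<^sub>R h' (s + \<sigma> * t)) 0"
    proof -
      have "isCont (\<lambda>t. s + \<sigma> * t) 0" by (intro continuous_intros)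
      moreover have "isCont h' (s + \<sigma> * 0)" using cont by (simp add: continuous_on_eq_continuous_at)
      ultimately have "isCont (\<lambda>t. h' (s + \<sigma> * t)) 0" by (rule isCont_o2)
      then show ?thesis by (intro continuous_intros)
    qed
  qed
  then have "((\<lambda>z. deriv (\<lambda>z. F (\<Phi> z)) z / deriv \<Phi> z) \<longlongrightarrow> \<sigma> *\<^sub>R h' (s + \<sigma> * 0) / deriv \<Phi> 0)
      (at 0 within {z. 0 < Im z})"
    by (intro tendsto_divide half_chart_tendsto_deriv nz)
  moreover have "\<sigma> *\<^sub>R h' (s + \<sigma> * 0) / deriv \<Phi> 0 = h' s / vector_derivative \<gamma> (at s)"
    using \<sigma> by (simp add: half_chart_deriv scaleR_conv_of_real)
  moreover have "\<forall>\<^sub>F z in at 0 within {z. 0 < Im z}. deriv (\<lambda>z. F (\<Phi> z)) z / deriv \<Phi> z = deriv F (\<Phi> z)"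
    using eventually_half_disc
    by eventually_elim (use chart in \<open>auto simp: half_chart_pullback(3) half_chart_def\<close>)
  ultimately show ?thesis by (auto intro: Lim_transform_eventually)
qed

end

section \<open>Induction on the finite order of differentiability\<close>

lemma Ap_space_enat_iff:
  assumes \<gamma>: "bounded_by_analytic_Jordan_curve \<Omega> \<gamma>" and \<Omega>: "open \<Omega>" and "F \<in> A_space \<Omega>"
  shows "F \<in> Ap_space (enat n) \<Omega> \<longleftrightarrow> F \<circ> \<gamma> \<in> C_real (enat n)"
  using \<open>F \<in> A_space \<Omega>\<close>
proof (induction n arbitrary: F)
  case 0
  \<comment> \<open>At order 0 both sides hold for every \<open>F\<close> in
    \<open>A_space \<Omega>\<close>.\<close>
  have "continuous_on UNIV \<gamma>"
    using holomorphically_extendable_imp_C_real[OF bounded_by_analytic_Jordan_curve_extendable[OF \<gamma>], of 0]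
    by (simp add: C_real_0_iff)
  moreover have "range \<gamma> \<subseteq> closure \<Omega>"
    using \<gamma> by (auto simp: bounded_by_analytic_Jordan_curve_def frontier_def)
  moreover have "continuous_on (closure \<Omega>) F" using 0 by (simp add: A_space_def)
  ultimately have "continuous_on UNIV (F \<circ> \<gamma>)"
    by (intro continuous_on_compose) (auto intro: continuous_on_subset)
  then show ?case using Ap_space_0[OF 0] by (simp add: C_real_0_iff)
next
  case (Suc n)
  define \<gamma>' where "\<gamma>' = (\<lambda>t. vector_derivative \<gamma> (at t))"
  have holF: "F holomorphic_on \<Omega>" using Suc.prems by (simp add: A_space_def)
  have nz: "\<gamma>' t \<noteq> 0" for t using \<gamma> by (simp add: bounded_by_analytic_Jordan_curve_def \<gamma>'_def)
  have ext: "holomorphically_extendable \<gamma>'"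
    unfolding \<gamma>'_def using bounded_by_analytic_Jordan_curve_extendable[OF \<gamma>]
    by (rule holomorphically_extendable_deriv)
  then have C: "\<gamma>' \<in> C_real (enat n)" "(\<lambda>t. inverse (\<gamma>' t)) \<in> C_real (enat n)"
    using nz by (auto intro: holomorphically_extendable_imp_C_real holomorphically_extendable_inverse)
  have vd: "((F \<circ> \<gamma>) has_vector_derivative F' (\<gamma> t) * \<gamma>' t) (at t)"
    if "continuous_extension \<Omega> (deriv F) F'" for F' t
    using half_chart_exists[OF \<gamma> \<Omega>, of t] half_chart_forward[OF \<gamma> \<Omega> _ Suc.prems that]
    unfolding \<gamma>'_def by blast
  \<comment> \<open>Once the extension \<open>F'\<close> exists, the induction hypothesis applies to
    it, and multiplying by \<open>\<gamma>'\<close> or its reciprocal translates between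
    \<open>F' \<circ> \<gamma>\<close> and the derivative of
    \<open>F \<circ> \<gamma>\<close>.\<close>
  have step: "F' \<in> Ap_space (enat n) \<Omega> \<longleftrightarrow> F \<circ> \<gamma> \<in> C_real (enat (Suc n))"
    if F': "continuous_extension \<Omega> (deriv F) F'" for F'
  proof -
    have "F' \<in> A_space \<Omega>" using continuous_extension_deriv_in_A_space[OF \<Omega> holF F'] .
    then have "F' \<in> Ap_space (enat n) \<Omega> \<longleftrightarrow> F' \<circ> \<gamma> \<in> C_real (enat n)" by (rule Suc.IH)
    also have "\<dots> \<longleftrightarrow> (\<lambda>t. F' (\<gamma> t) * \<gamma>' t) \<in> C_real (enat n)"
    proof
      assume "F' \<circ> \<gamma> \<in> C_real (enat n)"
      from C_real_mult[OF this C(1)] show "(\<lambda>t. F' (\<gamma> t) * \<gamma>' t) \<in> C_real (enat n)" by (simp add: o_def)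
    next
      assume "(\<lambda>t. F' (\<gamma> t) * \<gamma>' t) \<in> C_real (enat n)"
      from C_real_mult[OF this C(2)]
      have "(\<lambda>t. F' (\<gamma> t) * \<gamma>' t * inverse (\<gamma>' t)) \<in> C_real (enat n)" .
      moreover have "F' (\<gamma> t) * \<gamma>' t * inverse (\<gamma>' t) = F' (\<gamma> t)" for t using nz[of t] by simp
      ultimately show "F' \<circ> \<gamma> \<in> C_real (enat n)" by (simp add: o_def)
    qed
    also have "\<dots> \<longleftrightarrow> F \<circ> \<gamma> \<in> C_real (enat (Suc n))"
      using C_real_Suc_iff[OF vd[OF F']] by blast
    finally show ?thesis .
  qed
  \<comment> \<open>For \<open>F\<close> in \<open>Ap_space\<close> the extension is given. Here it
    is built from \<open>F \<circ> \<gamma>\<close> being \<open>C\<^sup>1\<close>: the charts yield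
    a limit of \<open>deriv F\<close> at each frontier point.\<close>
  have "\<exists>F'. continuous_extension \<Omega> (deriv F) F'" if CS: "F \<circ> \<gamma> \<in> C_real (enat (Suc n))"
  proof -
    obtain h' where h': "\<And>t. ((F \<circ> \<gamma>) has_vector_derivative h' t) (at t)" "h' \<in> C_real (enat n)"
      using C_real_SucE[OF CS] by blast
    have "h' \<in> C_real (enat 0)" using h'(2) by (rule C_real_mono) simp
    then have cont: "continuous_on UNIV h'" by (simp add: C_real_0_iff)
    have "\<exists>L. (deriv F \<longlongrightarrow> L) (at \<xi> within \<Omega>)" if "\<xi> \<in> frontier \<Omega>" for \<xi>
    proof -
      have "range \<gamma> = frontier \<Omega>" using \<gamma> by (simp add: bounded_by_analytic_Jordan_curve_def)
      with that have "\<xi> \<in> range \<gamma>" by simp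
      then obtain s where "\<xi> = \<gamma> s" ..
      moreover have "(deriv F \<longlongrightarrow> h' s / vector_derivative \<gamma> (at s)) (at (\<gamma> s) within \<Omega>)"
        by (rule tendsto_within_half_charts[OF \<gamma> \<Omega>])
           (rule half_chart_backward[OF \<gamma> \<Omega> _ Suc.prems h'(1) cont])
      ultimately show ?thesis by blast
    qed
    moreover have "continuous_on \<Omega> (deriv F)"
      using holF \<Omega> by (intro holomorphic_on_imp_continuous_on holomorphic_deriv)
    ultimately show ?thesis by (metis continuous_extension_exists[OF \<Omega>])
  qed
  then show ?case using step Ap_space_Suc_iff[OF \<Omega> Suc.prems] by blast
qed

theorem corollary4p3:
  fixes p :: enat and \<Omega> :: "complex set" and \<gamma> :: "real \<Rightarrow> complex"
    and f :: "complex \<Rightarrow> complex"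
  assumes "Jordan_domain \<Omega>"
    and "bounded_by_analytic_Jordan_curve \<Omega> \<gamma>"
    and "f \<in> A_space \<Omega>"
  shows "(f \<in> Ap_space p \<Omega> \<longleftrightarrow> f \<circ> \<gamma> \<in> C_real p) \<and>
    (f \<in> Ap_space p \<Omega> \<longrightarrow> 1 \<le> p \<longrightarrow>
      (\<forall>f'. continuous_extension \<Omega> (deriv f) f' \<longrightarrow>
        (\<forall>t. ((f \<circ> \<gamma>) has_vector_derivative
               f' (\<gamma> t) * vector_derivative \<gamma> (at t)) (at t))))"
proof -
  have \<Omega>: "open \<Omega>"
    using assms(1) by (auto simp: Jordan_domain_def intro!: open_inside closed_path_image simple_path_imp_path)
  have "f holomorphic_on \<Omega>" using assms(3) by (simp add: A_space_def)
  then have "f \<in> Ap_space p \<Omega> \<longleftrightarrow> f \<circ> \<gamma> \<in> C_real p"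
    \<comment> \<open>Both spaces are determined by the finite orders \<open>n \<le> p\<close>,
      which includes the case \<open>p = \<infinity>\<close>.\<close>
    unfolding Ap_space_iff_enat[OF \<open>f holomorphic_on \<Omega>\<close>, of p] C_real_iff_enat[of _ p]
    using Ap_space_enat_iff[OF assms(2) \<Omega> assms(3)] by blast
  moreover have "((f \<circ> \<gamma>) has_vector_derivative f' (\<gamma> t) * vector_derivative \<gamma> (at t)) (at t)"
    if "continuous_extension \<Omega> (deriv f) f'" for f' t
    using half_chart_exists[OF assms(2) \<Omega>, of t] half_chart_forward[OF assms(2) \<Omega> _ assms(3) that]
    by blast
  ultimately show ?thesis by blast
qed

end
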